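(* Let $(\mathfrak g,\mathfrak v,\pi)$ be a Lorentzian or a degenerate Lorentzian data set, let $\mathfrak n=\mathfrak n(\mathfrak g,\mathfrak v,\pi)=\mathfrak g\oplus\mathfrak v$ be the associated $2$-step nilpotent metric Lie algebra, and let $N$ be the simply connected Lie group with Lie algebra $\mathfrak n$, endowed with the left-invariant metric induced by the metric of $\mathfrak n$. Then $N$ is naturally reductive with respect to the Lie group $\mathrm{Iso}^{\mathrm{aut}}(N)=N\rtimes H^{\mathrm{aut}}$, and $N$ does not split off a flat factor. Moreover, the linear map $\xi:\mathfrak n\to\mathfrak h^{\mathrm{aut}}$ defined by $$\xi(Z+X)=(\mathrm{ad}^{\mathfrak g}_Z,\ \pi(Z)),\qquad Z\in\mathfrak g,\ X\in\mathfrak v,$$ (where the pair acts on $\mathfrak g\oplus\mathfrak v$ componentwise) is a linear, $\mathrm{ad}(\mathfrak h^{\mathrm{aut}})$-equivariant geodesic graph for $\mathfrak n$.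
   Context: A metric on a real vector space is a non-degenerate symmetric bilinear form; Lorentzian means exactly one negative direction; $\mathfrak{so}$ denotes skew-symmetric endomorphisms. A data set is a triple $(\mathfrak g,\mathfrak v,\pi)$ where $\mathfrak g$ is a (finite-dimensional real) Lie algebra with an $\mathrm{ad}$-invariant metric $\langle\cdot,\cdot\rangle_{\mathfrak g}$ (each $\mathrm{ad}_Z$ is skew-symmetric), $\mathfrak v$ is a real vector space with a metric $\langle\cdot,\cdot\rangle_{\mathfrak v}$, and $\pi:\mathfrak g\to\mathfrak{so}(\mathfrak v,\langle\cdot,\cdot\rangle_{\mathfrak v})$ is a faithful representation. Its associated metric Lie algebra $\mathfrak n(\mathfrak g,\mathfrak v,\pi)$ is $\mathfrak n=\mathfrak g\oplus\mathfrak v$ with the orthogonal direct sum metric $\langle\cdot,\cdot\rangle$ and bracket given by $[\mathfrak g,\mathfrak n]=0$, $[\mathfrak v,\mathfrak v]\subset\mathfrak g$, $\langle[X,Y],Z\rangle=\langle\pi(Z)X,Y\rangle$ for $X,Y\in\mathfrak v$, $Z\in\mathfrak g$. Assume the metric on $\mathfrak n$ is Lorentzian. The data set is called a Lorentzian data set if $\bigcap_{Z\in\mathfrak g}\ker\pi(Z)=\{0\}$, and a degenerate Lorentzian data set if $\bigcap_{Z\in\mathfrak g}\ker\pi(Z)=\mathbb R E$ for some $0\neq E\in\mathfrak v$ with $\langle E,E\rangle=0$. $H^{\mathrm{aut}}$ is the group of isometric automorphisms of $N$, with Lie algebra $\mathfrak h^{\mathrm{aut}}=\mathrm{Der}(\mathfrak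 n)\cap\mathfrak{so}(\mathfrak n)$; $\mathrm{Iso}^{\mathrm{aut}}(N)=N\rtimes H^{\mathrm{aut}}$ has Lie algebra $\mathfrak n\rtimes\mathfrak h^{\mathrm{aut}}$ with $[A,U]=A(U)$ for $A\in\mathfrak h^{\mathrm{aut}}$, $U\in\mathfrak n$. A pseudo-Riemannian homogeneous space $M=G/K$ ($G\subset\mathrm{Iso}(M)$, $K$ isotropy at a base point) is naturally reductive with respect to $G$ if $\mathrm{Lie}(G)=\mathfrak k\oplus\mathfrak m$ with $\mathfrak m$ $\mathrm{ad}(\mathfrak k)$-invariant and $\langle[U,V]_{\mathfrak m},W\rangle+\langle V,[U,W]_{\mathfrak m}\rangle=0$ for all $U,V,W\in\mathfrak m$, where $\mathfrak m$ carries the form obtained by identifying it with the tangent space at the base point. A linear map $\xi:\mathfrak n\to\mathfrak h^{\mathrm{aut}}$ is $\mathrm{ad}(\mathfrak h^{\mathrm{aut}})$-equivariant if $\xi(L(A))=[L,\xi(A)]$ for all $L\in\mathfrak h^{\mathrm{aut}}$, $A\in\mathfrak n$; it is a geodesic graph if $\langle[A+\xi(A),B]_{\mathfrak n},A\rangle=0$ for all $A,B\in\mathfrak n$, the bracket being that of $\mathfrak n\rtimes\mathfrak h^{\mathrm{aut}}$ and $[\cdot,\cdot]_{\mathfrak n}$ its $\mathfrak n$-component. A simply connected pseudo-Riemannian manifold splits off a flat factor if it is isometric to a product $M_0\times M'$ with $M_0\simeq\mathbb R^k$ ($k\ge1$) a pseudo-Riemannian flat space form and $M'$ pseudo-Riemannian.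 *)

theory Defs
  imports "HOL-Analysis.Analysis"
begin

text \<open>
  Conventions. Finite-dimensional real vector spaces are types of class
  \<^class>\<open>euclidean_space\<close>; the inner product carried by that class only provides the topology and
  plays no geometric role. All metrics below are explicit bilinear forms of arbitrary signature.
\<close>

section \<open>Metrics, metric Lie algebras, data sets\<close>

definition metric_form :: "('a::real_vector \<Rightarrow> 'a \<Rightarrow> real) \<Rightarrow> bool" where
  "metric_form b \<longleftrightarrow> bilinear b \<and> (\<forall>x y. b x y = b y x) \<and> (\<forall>x. (\<forall>y. b x y = 0) \<longrightarrow> x = 0)"

definition lorentzian_form :: "('a::real_vector \<Rightarrow> 'a \<Rightarrow> real) \<Rightarrow> bool" where
  "lorentzian_form b \<longleftrightarrow> metric_form b \<and>
     (\<exists>B. finite B \<and> independent B \<and> span B = UNIV \<and>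
        (\<forall>x\<in>B. \<forall>y\<in>B. x \<noteq> y \<longrightarrow> b x y = 0) \<and>
        (\<forall>x\<in>B. b x x = 1 \<or> b x x = - 1) \<and>
        card {x\<in>B. b x x = - 1} = 1)"

definition so_form :: "('a::real_vector \<Rightarrow> 'a \<Rightarrow> real) \<Rightarrow> ('a \<Rightarrow> 'a) set" where
  "so_form b = {A. linear A \<and> (\<forall>x y. b (A x) y + b x (A y) = 0)}"

definition lie_bracket :: "('a::real_vector \<Rightarrow> 'a \<Rightarrow> 'a) \<Rightarrow> bool" where
  "lie_bracket br \<longleftrightarrow> bilinear br \<and> (\<forall>x. br x x = 0) \<and>
     (\<forall>x y z. br x (br y z) + br y (br z x) + br z (br x y) = 0)"

definition commutator :: "('a::real_vector \<Rightarrow> 'a) \<Rightarrow> ('a \<Rightarrow> 'a) \<Rightarrow> 'a \<Rightarrow> 'a" where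
  "commutator A B = (\<lambda>x. A (B x) - B (A x))"

text \<open>
  Bilinearity of \<open>\<pi>\<close> says that every \<open>\<pi> Z\<close> is linear and that \<open>\<pi>\<close> is linear in \<open>Z\<close>.
\<close>

definition faithful_so_representation ::
  "('g::real_vector \<Rightarrow> 'g \<Rightarrow> 'g) \<Rightarrow> ('v::real_vector \<Rightarrow> 'v \<Rightarrow> real) \<Rightarrow> ('g \<Rightarrow> 'v \<Rightarrow> 'v) \<Rightarrow> bool" where
  "faithful_so_representation br bv \<pi> \<longleftrightarrow> bilinear \<pi> \<and> (\<forall>Z. \<pi> Z \<in> so_form bv) \<and>
     (\<forall>Z W. \<pi> (br Z W) = commutator (\<pi> Z) (\<pi> W)) \<and> inj \<pi>"

definition data_set ::
  "('g::euclidean_space \<Rightarrow> 'g \<Rightarrow> 'g) \<Rightarrow> ('g \<Rightarrow> 'g \<Rightarrow> real) \<Rightarrow> ('v::euclidean_space \<Rightarrow> 'v \<Rightarrow> real) \<Rightarrow>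
   ('g \<Rightarrow> 'v \<Rightarrow> 'v) \<Rightarrow> bool" where
  "data_set br bg bv \<pi> \<longleftrightarrow>
     lie_bracket br \<and> metric_form bg \<and> (\<forall>Z. br Z \<in> so_form bg) \<and>
     metric_form bv \<and> faithful_so_representation br bv \<pi>"

definition n_metric ::
  "('g::real_vector \<Rightarrow> 'g \<Rightarrow> real) \<Rightarrow> ('v::real_vector \<Rightarrow> 'v \<Rightarrow> real) \<Rightarrow> 'g \<times> 'v \<Rightarrow> 'g \<times> 'v \<Rightarrow> real" where
  "n_metric bg bv p q = bg (fst p) (fst q) + bv (snd p) (snd q)"

definition n_bracket ::
  "('g::real_vector \<Rightarrow> 'g \<Rightarrow> real) \<Rightarrow> ('v::real_vector \<Rightarrow> 'v \<Rightarrow> real) \<Rightarrow> ('g \<Rightarrow> 'v \<Rightarrow> 'v) \<Rightarrow>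
   'g \<times> 'v \<Rightarrow> 'g \<times> 'v \<Rightarrow> 'g \<times> 'v" where
  "n_bracket bg bv \<pi> p q = (THE W. \<forall>Z. bg W Z = bv (\<pi> Z (snd p)) (snd q), 0)"

definition common_kernel :: "('g \<Rightarrow> 'v::real_vector \<Rightarrow> 'v) \<Rightarrow> 'v set" where
  "common_kernel \<pi> = (\<Inter>Z. {X. \<pi> Z X = 0})"

definition lorentzian_data_set ::
  "('g::euclidean_space \<Rightarrow> 'g \<Rightarrow> 'g) \<Rightarrow> ('g \<Rightarrow> 'g \<Rightarrow> real) \<Rightarrow> ('v::euclidean_space \<Rightarrow> 'v \<Rightarrow> real) \<Rightarrow>
   ('g \<Rightarrow> 'v \<Rightarrow> 'v) \<Rightarrow> bool" where
  "lorentzian_data_set br bg bv \<pi> \<longleftrightarrow>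
     data_set br bg bv \<pi> \<and> lorentzian_form (n_metric bg bv) \<and> common_kernel \<pi> = {0}"

definition degenerate_lorentzian_data_set ::
  "('g::euclidean_space \<Rightarrow> 'g \<Rightarrow> 'g) \<Rightarrow> ('g \<Rightarrow> 'g \<Rightarrow> real) \<Rightarrow> ('v::euclidean_space \<Rightarrow> 'v \<Rightarrow> real) \<Rightarrow>
   ('g \<Rightarrow> 'v \<Rightarrow> 'v) \<Rightarrow> bool" where
  "degenerate_lorentzian_data_set br bg bv \<pi> \<longleftrightarrow>
     data_set br bg bv \<pi> \<and> lorentzian_form (n_metric bg bv) \<and>
     (\<exists>E. E \<noteq> 0 \<and> bv E E = 0 \<and> common_kernel \<pi> = range (\<lambda>t. t *\<^sub>R E))"

section \<open>Smooth maps and pseudo-Riemannian manifolds\<close>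

text \<open>Both notions are meant for open sets \<open>S\<close>.\<close>

primrec Ck_on :: "nat \<Rightarrow> ('a::euclidean_space \<Rightarrow> 'b::euclidean_space) \<Rightarrow> 'a set \<Rightarrow> bool" where
  "Ck_on 0 f S \<longleftrightarrow> continuous_on S f"
| "Ck_on (Suc k) f S \<longleftrightarrow> (\<forall>x\<in>S. f differentiable (at x)) \<and>
     (\<forall>v. Ck_on k (\<lambda>x. frechet_derivative f (at x) v) S)"

definition smooth_on :: "('a::euclidean_space \<Rightarrow> 'b::euclidean_space) \<Rightarrow> 'a set \<Rightarrow> bool" where
  "smooth_on f S \<longleftrightarrow> (\<forall>k. Ck_on k f S)"

text \<open>
  A pseudo-Riemannian manifold on the type \<open>'m\<close>, modelled on \<open>'e\<close>, is an atlas of charts, each of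
  which carries the coordinate expression of the metric: \<open>chart_metric c x u v\<close> is the value at the
  point with coordinates \<open>x\<close> on the vectors with components \<open>u\<close>, \<open>v\<close>. That these expressions define
  one metric tensor means that the coordinate changes preserve them.
\<close>

record ('m, 'e) metric_chart =
  chart_dom :: "'m set"
  chart_map :: "'m \<Rightarrow> 'e"
  chart_metric :: "'e \<Rightarrow> 'e \<Rightarrow> 'e \<Rightarrow> real"

text \<open>The map \<open>\<phi>\<close>, read in the charts \<open>c\<close> and \<open>d\<close>, is smooth and preserves the metrics.\<close>

definition chart_isometric ::
  "('m, 'e::euclidean_space) metric_chart \<Rightarrow> ('p, 'f::euclidean_space) metric_chart \<Rightarrow> ('m \<Rightarrow> 'p) \<Rightarrow> bool"
  where
  "chart_isometric c d \<phi> \<longleftrightarrow>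
     (let S = chart_map c ` (chart_dom c \<inter> \<phi> -` chart_dom d);
          F = chart_map d \<circ> \<phi> \<circ> inv_into (chart_dom c) (chart_map c)
      in smooth_on F S \<and>
         (\<forall>x\<in>S. \<forall>u v. chart_metric d (F x) (frechet_derivative F (at x) u) (frechet_derivative F (at x) v)
                       = chart_metric c x u v))"

definition metric_chart_ok :: "('m::topological_space, 'e::euclidean_space) metric_chart \<Rightarrow> bool" where
  "metric_chart_ok c \<longleftrightarrow>
     open (chart_dom c) \<and> open (chart_map c ` chart_dom c) \<and>
     homeomorphism (chart_dom c) (chart_map c ` chart_dom c)
       (chart_map c) (inv_into (chart_dom c) (chart_map c)) \<and>
     (\<forall>x\<in>chart_map c ` chart_dom c. metric_form (chart_metric c x)) \<and>
     (\<forall>u v. smooth_on (\<lambda>x. chart_metric c x u v) (chart_map c ` chart_dom c))"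

definition pseudo_riemannian_manifold ::
  "('m::{t2_space, second_countable_topology}, 'e::euclidean_space) metric_chart set \<Rightarrow> bool" where
  "pseudo_riemannian_manifold M \<longleftrightarrow>
     (\<Union>c\<in>M. chart_dom c) = UNIV \<and> (\<forall>c\<in>M. metric_chart_ok c) \<and>
     (\<forall>c\<in>M. \<forall>d\<in>M. chart_isometric c d id)"

definition isometry ::
  "('m::topological_space, 'e::euclidean_space) metric_chart set \<Rightarrow>
   ('p::topological_space, 'f::euclidean_space) metric_chart set \<Rightarrow> ('m \<Rightarrow> 'p) \<Rightarrow> bool" where
  "isometry M P \<phi> \<longleftrightarrow> homeomorphism UNIV UNIV \<phi> (inv \<phi>) \<and>
     (\<forall>c\<in>M. \<forall>d\<in>P. chart_isometric c d \<phi> \<and> chart_isometric d c (inv \<phi>))"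

text \<open>A metric tensor \<open>g\<close> (base point first) on a whole vector space, as a manifold with one chart.\<close>

definition global_manifold ::
  "('a::euclidean_space \<Rightarrow> 'a \<Rightarrow> 'a \<Rightarrow> real) \<Rightarrow> ('a, 'a) metric_chart set" where
  "global_manifold g = {\<lparr>chart_dom = UNIV, chart_map = id, chart_metric = g\<rparr>}"

definition product_chart ::
  "('m, 'e) metric_chart \<Rightarrow> ('p, 'f) metric_chart \<Rightarrow> ('m \<times> 'p, 'e \<times> 'f) metric_chart" where
  "product_chart c d =
     \<lparr>chart_dom = chart_dom c \<times> chart_dom d,
      chart_map = map_prod (chart_map c) (chart_map d),
      chart_metric = (\<lambda>x u v. chart_metric c (fst x) (fst u) (fst v)
                            + chart_metric d (snd x) (snd u) (snd v))\<rparr>"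

definition product_manifold ::
  "('m, 'e) metric_chart set \<Rightarrow> ('p, 'f) metric_chart set \<Rightarrow> ('m \<times> 'p, 'e \<times> 'f) metric_chart set" where
  "product_manifold M P = {product_chart c d | c d. c \<in> M \<and> d \<in> P}"

text \<open>
  The manifold \<open>N\<close> is isometric to a product of a flat space \<open>\<real>\<^sup>k\<close>, \<open>k \<ge> 1\<close> (the type \<open>'k\<close> with a constant
  metric), and a pseudo-Riemannian manifold \<open>M'\<close> on the type \<open>'m\<close>, modelled on \<open>'e\<close>. As types of class
  \<^class>\<open>euclidean_space\<close> have positive dimension, the case where \<open>M'\<close> is zero-dimensional, i.e. a point
  (for connected \<open>N\<close>), is listed separately. ``\<open>N\<close> does not split off a flat factor'' is the negation
  of this for all types \<open>'k\<close>, \<open>'m\<close>, \<open>'e\<close>.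
\<close>

definition splits_off_flat_factor ::
  "'k::euclidean_space itself \<Rightarrow> 'm::{t2_space, second_countable_topology} itself \<Rightarrow>
   'e::euclidean_space itself \<Rightarrow> ('p::topological_space, 'f::euclidean_space) metric_chart set \<Rightarrow> bool" where
  "splits_off_flat_factor _ _ _ N \<longleftrightarrow>
     (\<exists>g0 :: 'k \<Rightarrow> 'k \<Rightarrow> real. metric_form g0 \<and>
        ((\<exists>(M' :: ('m, 'e) metric_chart set) \<phi>. pseudo_riemannian_manifold M' \<and>
            isometry N (product_manifold (global_manifold (\<lambda>_. g0)) M') \<phi>) \<or>
         (\<exists>\<phi>. isometry N (global_manifold (\<lambda>_. g0)) \<phi>)))"

section \<open>Naturally reductive homogeneous spaces\<close>

text \<open>
  The manifold is a vector space \<open>'a\<close> with a metric tensor \<open>g\<close>, and \<open>G\<close> is a group of transformations of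
  it. An element of \<open>Lie(G)\<close> is represented by the vector field on \<open>'a\<close> generated by the corresponding
  one-parameter subgroup; this is injective since \<open>G\<close> acts effectively.
\<close>

definition transformation_lie_algebra :: "('a::euclidean_space \<Rightarrow> 'a) set \<Rightarrow> ('a \<Rightarrow> 'a) set" where
  "transformation_lie_algebra G =
     {U. \<exists>\<gamma> :: real \<Rightarrow> 'a \<Rightarrow> 'a.
           (\<forall>t. \<gamma> t \<in> G) \<and> (\<forall>s t. \<gamma> (s + t) = \<gamma> s \<circ> \<gamma> t) \<and>
           smooth_on (\<lambda>(t, x). \<gamma> t x) UNIV \<and>
           (\<forall>x. ((\<lambda>t. \<gamma> t x) has_vector_derivative U x) (at 0))}"

text \<open>
  This is minus the usual bracket of vector fields, the sign for which the identification of \<open>Lie(G)\<close>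
  with vector fields is a homomorphism.
\<close>

definition transformation_bracket ::
  "('a::euclidean_space \<Rightarrow> 'a) \<Rightarrow> ('a \<Rightarrow> 'a) \<Rightarrow> 'a \<Rightarrow> 'a" where
  "transformation_bracket U V =
     (\<lambda>x. frechet_derivative U (at x) (V x) - frechet_derivative V (at x) (U x))"

definition vf_subspace :: "('a::real_vector \<Rightarrow> 'a) set \<Rightarrow> bool" where
  "vf_subspace S \<longleftrightarrow> (\<lambda>x. 0) \<in> S \<and> (\<forall>U\<in>S. \<forall>V\<in>S. (\<lambda>x. U x + V x) \<in> S) \<and>
     (\<forall>U\<in>S. \<forall>c. (\<lambda>x. c *\<^sub>R U x) \<in> S)"

definition vf_direct_sum :: "('a::real_vector \<Rightarrow> 'a) set \<Rightarrow> ('a \<Rightarrow> 'a) set \<Rightarrow> ('a \<Rightarrow> 'a) set \<Rightarrow> bool" where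
  "vf_direct_sum L k m \<longleftrightarrow> vf_subspace L \<and> vf_subspace k \<and> vf_subspace m \<and>
     k \<inter> m = {\<lambda>x. 0} \<and> L = {\<lambda>x. K x + U x | K U. K \<in> k \<and> U \<in> m}"

definition vf_component :: "('a::real_vector \<Rightarrow> 'a) set \<Rightarrow> ('a \<Rightarrow> 'a) set \<Rightarrow> ('a \<Rightarrow> 'a) \<Rightarrow> 'a \<Rightarrow> 'a" where
  "vf_component k m U = (THE P. P \<in> m \<and> (\<lambda>x. U x - P x) \<in> k)"

text \<open>
  The isotropy algebra at \<open>p\<close> consists of the fields vanishing at \<open>p\<close>, and \<open>m\<close> is identified with the
  tangent space at \<open>p\<close> by evaluation at \<open>p\<close>.
\<close>

definition naturally_reductive ::
  "('a::euclidean_space \<Rightarrow> 'a \<Rightarrow> 'a \<Rightarrow> real) \<Rightarrow> ('a \<Rightarrow> 'a) set \<Rightarrow> 'a \<Rightarrow> bool" where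
  "naturally_reductive g G p \<longleftrightarrow>
     pseudo_riemannian_manifold (global_manifold g) \<and>
     (\<forall>\<phi>\<in>G. isometry (global_manifold g) (global_manifold g) \<phi>) \<and>
     id \<in> G \<and> (\<forall>\<phi>\<in>G. \<forall>\<psi>\<in>G. \<phi> \<circ> \<psi> \<in> G) \<and> (\<forall>\<phi>\<in>G. inv \<phi> \<in> G) \<and>
     (\<forall>x y. \<exists>\<phi>\<in>G. \<phi> x = y) \<and>
     (let L = transformation_lie_algebra G; k = {U \<in> L. U p = 0}
      in \<exists>m. vf_direct_sum L k m \<and>
           (\<forall>K\<in>k. \<forall>U\<in>m. transformation_bracket K U \<in> m) \<and>
           (\<forall>U\<in>m. \<forall>V\<in>m. \<forall>W\<in>m.
              g p (vf_component k m (transformation_bracket U V) p) (W p) +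
              g p (V p) (vf_component k m (transformation_bracket U W) p) = 0))"

section \<open>The simply connected group of a 2-step nilpotent metric Lie algebra\<close>

text \<open>
  The simply connected Lie group with 2-step nilpotent Lie algebra \<open>('a, nb)\<close> is realised, via its
  exponential map (a diffeomorphism), on the vector space \<open>'a\<close> itself with the
  Baker-Campbell-Hausdorff product; the neutral element is \<open>0\<close> and the inverse of \<open>p\<close> is \<open>- p\<close>.
\<close>

definition bch_mult :: "('a::real_vector \<Rightarrow> 'a \<Rightarrow> 'a) \<Rightarrow> 'a \<Rightarrow> 'a \<Rightarrow> 'a" where
  "bch_mult nb p q = p + q + (1/2) *\<^sub>R nb p q"

definition left_invariant_metric ::
  "('a::euclidean_space \<Rightarrow> 'a \<Rightarrow> 'a) \<Rightarrow> ('a \<Rightarrow> 'a \<Rightarrow> real) \<Rightarrow> 'a \<Rightarrow> 'a \<Rightarrow> 'a \<Rightarrow> real" where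
  "left_invariant_metric nb b p u v =
     b (frechet_derivative (bch_mult nb (- p)) (at p) u) (frechet_derivative (bch_mult nb (- p)) (at p) v)"

definition isometric_automorphisms ::
  "('a::euclidean_space \<Rightarrow> 'a \<Rightarrow> 'a) \<Rightarrow> ('a \<Rightarrow> 'a \<Rightarrow> real) \<Rightarrow> ('a \<Rightarrow> 'a) set" where
  "isometric_automorphisms nb b =
     {h. bij h \<and> (\<forall>p q. h (bch_mult nb p q) = bch_mult nb (h p) (h q)) \<and>
         isometry (global_manifold (left_invariant_metric nb b)) (global_manifold (left_invariant_metric nb b)) h}"

text \<open>The semidirect product of \<open>N\<close> and \<open>H\<^sup>a\<^sup>u\<^sup>t\<close>, as a group of transformations of \<open>N\<close>.\<close>

definition Iso_aut ::
  "('a::euclidean_space \<Rightarrow> 'a \<Rightarrow> 'a) \<Rightarrow> ('a \<Rightarrow> 'a \<Rightarrow> real) \<Rightarrow> ('a \<Rightarrow> 'a) set" where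
  "Iso_aut nb b = {bch_mult nb p \<circ> h | p h. h \<in> isometric_automorphisms nb b}"

definition derivations :: "('a::real_vector \<Rightarrow> 'a \<Rightarrow> 'a) \<Rightarrow> ('a \<Rightarrow> 'a) set" where
  "derivations nb = {D. linear D \<and> (\<forall>x y. D (nb x y) = nb (D x) y + nb x (D y))}"

definition h_aut :: "('a::real_vector \<Rightarrow> 'a \<Rightarrow> 'a) \<Rightarrow> ('a \<Rightarrow> 'a \<Rightarrow> real) \<Rightarrow> ('a \<Rightarrow> 'a) set" where
  "h_aut nb b = derivations nb \<inter> so_form b"

text \<open>A pair \<open>(U, A)\<close> stands for \<open>U + A\<close> with \<open>U\<close> in the Lie algebra \<open>'a\<close> and \<open>A\<close> in \<^const>\<open>h_aut\<close>.\<close>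

definition semidirect_bracket ::
  "('a::real_vector \<Rightarrow> 'a \<Rightarrow> 'a) \<Rightarrow> 'a \<times> ('a \<Rightarrow> 'a) \<Rightarrow> 'a \<times> ('a \<Rightarrow> 'a) \<Rightarrow> 'a \<times> ('a \<Rightarrow> 'a)" where
  "semidirect_bracket nb = (\<lambda>(U, A) (V, B). (nb U V + A V - B U, commutator A B))"

definition linear_into_h_aut ::
  "('a::real_vector \<Rightarrow> 'a \<Rightarrow> 'a) \<Rightarrow> ('a \<Rightarrow> 'a \<Rightarrow> real) \<Rightarrow> ('a \<Rightarrow> 'a \<Rightarrow> 'a) \<Rightarrow> bool" where
  "linear_into_h_aut nb b \<xi> \<longleftrightarrow> (\<forall>A. \<xi> A \<in> h_aut nb b) \<and> (\<forall>x. linear (\<lambda>A. \<xi> A x))"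

definition h_aut_equivariant ::
  "('a::real_vector \<Rightarrow> 'a \<Rightarrow> 'a) \<Rightarrow> ('a \<Rightarrow> 'a \<Rightarrow> real) \<Rightarrow> ('a \<Rightarrow> 'a \<Rightarrow> 'a) \<Rightarrow> bool" where
  "h_aut_equivariant nb b \<xi> \<longleftrightarrow> (\<forall>L\<in>h_aut nb b. \<forall>A. \<xi> (L A) = commutator L (\<xi> A))"

definition geodesic_graph ::
  "('a::real_vector \<Rightarrow> 'a \<Rightarrow> 'a) \<Rightarrow> ('a \<Rightarrow> 'a \<Rightarrow> real) \<Rightarrow> ('a \<Rightarrow> 'a \<Rightarrow> 'a) \<Rightarrow> bool" where
  "geodesic_graph nb b \<xi> \<longleftrightarrow>
     (\<forall>A B. b (fst (semidirect_bracket nb (A, \<xi> A) (B, \<lambda>x. 0))) A = 0)"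

definition xi_map ::
  "('g \<Rightarrow> 'g \<Rightarrow> 'g) \<Rightarrow> ('g \<Rightarrow> 'v \<Rightarrow> 'v) \<Rightarrow> 'g \<times> 'v \<Rightarrow> 'g \<times> 'v \<Rightarrow> 'g \<times> 'v" where
  "xi_map br \<pi> = (\<lambda>(Z, X) (W, Y). (br Z W, \<pi> Z Y))"

section \<open>Consistency of the encodings\<close>

lemma metric_form_representation:
  fixes b :: "'a::euclidean_space \<Rightarrow> 'a \<Rightarrow> real"
  assumes b: "metric_form b" and f: "linear f"
  shows "\<exists>!W. \<forall>Z. b W Z = f Z"
proof -
  have bl: "bilinear b" and nd: "\<And>x. (\<forall>y. b x y = 0) \<Longrightarrow> x = 0"
    using b by (auto simp: metric_form_def)
  have lr: "linear (b x)" for x using bl by (simp add: bilinear_def)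
  have ll: "linear (\<lambda>x. b x y)" for y using bl by (simp add: bilinear_def)
  have ext: "f = h" if "linear f" "linear h" "\<And>e. e \<in> Basis \<Longrightarrow> f e = h e"
    for f h :: "'a \<Rightarrow> real"
    using linear_eq_stdbasis[OF that] by auto
  define T where "T W = (\<Sum>e\<in>Basis. b W e *\<^sub>R e)" for W
  have linT: "linear T"
    unfolding T_def
    by (intro linear_compose_sum ballI linearI)
       (simp_all add: linear_add[OF ll] linear_scale[OF ll] scaleR_add_left)
  have T_inner: "T W \<bullet> e = b W e" if "e \<in> Basis" for W e
    using that by (simp add: T_def inner_sum_left_Basis)
  have "inj T"
  proof (subst linear_injective_0[OF linT], intro allI impI)
    fix W assume "T W = 0"
    then have "b W e = 0" if "e \<in> Basis" for e using T_inner[OF that, of W] by simp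
    then have "b W = (\<lambda>_. 0)" by (intro ext[OF lr]) (auto simp: linear_iff)
    then show "W = 0" using nd by metis
  qed
  then have "surj T" using linT linear_injective_imp_surjective by blast
  then obtain W where W: "T W = (\<Sum>e\<in>Basis. f e *\<^sub>R e)" by (metis surjD)
  have "b W e = f e" if "e \<in> Basis" for e
    using that T_inner[OF that, of W] by (simp add: W inner_sum_left_Basis)
  then have "b W = f" by (intro ext[OF lr f])
  moreover have "W' = W" if "\<forall>Z. b W' Z = f Z" for W'
  proof -
    have "b (W' - W) Z = 0" for Z
      using that \<open>b W = f\<close> linear_diff[OF ll, of W' W Z] by simp
    then show ?thesis using nd[of "W' - W"] by simp
  qed
  ultimately show ?thesis by metis
qed

lemma n_bracket_characterization:
  assumes "data_set br bg bv \<pi>"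
  shows "bg (fst (n_bracket bg bv \<pi> p q)) Z = bv (\<pi> Z (snd p)) (snd q)"
    and "snd (n_bracket bg bv \<pi> p q) = 0"
proof -
  have pi: "bilinear \<pi>" and bg: "metric_form bg" and bv: "bilinear bv"
    using assms by (auto simp: data_set_def faithful_so_representation_def metric_form_def)
  have "linear (\<lambda>Z. bv (\<pi> Z (snd p)) (snd q))"
    by (rule linearI)
       (simp_all add: bilinear_ladd[OF pi] bilinear_ladd[OF bv] bilinear_lmul[OF pi] bilinear_lmul[OF bv])
  from theI'[OF metric_form_representation[OF bg this]]
  show "bg (fst (n_bracket bg bv \<pi> p q)) Z = bv (\<pi> Z (snd p)) (snd q)"
    by (simp add: n_bracket_def)
  show "snd (n_bracket bg bv \<pi> p q) = 0" by (simp add: n_bracket_def)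
qed

lemma n_bracket_two_step_nilpotent:
  assumes "data_set br bg bv \<pi>"
  shows "lie_bracket (n_bracket bg bv \<pi>)"
    and "n_bracket bg bv \<pi> p (n_bracket bg bv \<pi> q r) = 0"
proof -
  let ?n = "n_bracket bg bv \<pi>"
  have pi: "bilinear \<pi>" and bg: "bilinear bg" and bv: "bilinear bv"
    and nd: "\<And>x. (\<forall>y. bg x y = 0) \<Longrightarrow> x = 0" and sym: "\<And>x y. bv x y = bv y x"
    and so: "\<And>Z x y. bv (\<pi> Z x) y + bv x (\<pi> Z y) = 0" and lin: "\<And>Z. linear (\<pi> Z)"
    using assms by (auto simp: data_set_def faithful_so_representation_def metric_form_def so_form_def)
  note ch = n_bracket_characterization[OF assms]
  have eqI: "x = y" if "\<And>Z. bg (fst x) Z = bg (fst y) Z" "snd x = snd y" for x y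
    using that nd[of "fst x - fst y"] by (simp add: bilinear_lsub[OF bg] prod_eq_iff)
  show nil: "?n p (?n q r) = 0" for p q r
    by (rule eqI) (simp_all add: ch bilinear_lzero[OF bg] bilinear_rzero[OF bv])
  have "?n p p = 0" for p
  proof (rule eqI)
    fix Z show "bg (fst (?n p p)) Z = bg (fst 0) Z"
      using so[of Z "snd p" "snd p"] sym[of "snd p"] by (simp add: ch bilinear_lzero[OF bg])
  qed (simp add: ch)
  moreover have "bilinear ?n"
    unfolding bilinear_def
    by (intro conjI allI linearI eqI)
       (simp_all add: ch bilinear_ladd[OF bg] bilinear_lmul[OF bg] bilinear_ladd[OF bv] bilinear_lmul[OF bv]
          bilinear_radd[OF bv] bilinear_rmul[OF bv] linear_add[OF lin] linear_scale[OF lin])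
  ultimately show "lie_bracket ?n"
    by (simp add: lie_bracket_def nil)
qed

lemma bch_mult_group:
  assumes lie: "lie_bracket nb" and nil: "\<And>x y z. nb x (nb y z) = 0"
  shows "bch_mult nb (bch_mult nb p q) r = bch_mult nb p (bch_mult nb q r)"
    and "bch_mult nb 0 p = p" and "bch_mult nb p 0 = p"
    and "bch_mult nb p (- p) = 0" and "bch_mult nb (- p) p = 0"
proof -
  have bl: "bilinear nb" and alt: "\<And>x. nb x x = 0" using lie by (auto simp: lie_bracket_def)
  have skew: "nb x y = - nb y x" for x y
    using alt[of "x + y"] alt[of x] alt[of y]
    by (simp add: bilinear_ladd[OF bl] bilinear_radd[OF bl] eq_neg_iff_add_eq_0 add.commute)
  have nil': "nb (nb x y) z = 0" for x y z using skew[of "nb x y" z] nil by simp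
  note s = bilinear_ladd[OF bl] bilinear_radd[OF bl] bilinear_lmul[OF bl] bilinear_rmul[OF bl]
    bilinear_lneg[OF bl] bilinear_rneg[OF bl] bilinear_lzero[OF bl] bilinear_rzero[OF bl] nil nil' alt
  show "bch_mult nb (bch_mult nb p q) r = bch_mult nb p (bch_mult nb q r)"
    by (simp add: bch_mult_def s algebra_simps)
  show "bch_mult nb 0 p = p" "bch_mult nb p 0 = p" "bch_mult nb p (- p) = 0" "bch_mult nb (- p) p = 0"
    by (simp_all add: bch_mult_def s)
qed

text \<open>
  The left-invariant vector field with value \<open>u\<close> at \<open>0\<close>; the usual bracket of vector fields is minus
  \<^const>\<open>transformation_bracket\<close>. So the Lie algebra of the group is \<open>('a, nb)\<close>.
\<close>

lemma bch_mult_lie_algebra: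
  fixes nb :: "'a::euclidean_space \<Rightarrow> 'a \<Rightarrow> 'a"
  assumes lie: "lie_bracket nb" and nil: "\<And>x y z. nb x (nb y z) = 0"
  defines "LI \<equiv> \<lambda>u p. frechet_derivative (bch_mult nb p) (at 0) u"
  shows "transformation_bracket (LI u) (LI v) p = - LI (nb u v) p"
proof -
  have bl: "bilinear nb" and alt: "\<And>x. nb x x = 0" using lie by (auto simp: lie_bracket_def)
  have skew: "nb x y = - nb y x" for x y
    using alt[of "x + y"] alt[of x] alt[of y]
    by (simp add: bilinear_ladd[OF bl] bilinear_radd[OF bl] eq_neg_iff_add_eq_0 add.commute)
  have bb: "bounded_bilinear nb" using bl by (simp add: bilinear_conv_bounded_bilinear)
  note [derivative_intros] = bounded_bilinear.FDERIV[OF bb]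
  have LI: "LI u = (\<lambda>p. u + (1/2) *\<^sub>R nb p u)" for u
  proof
    fix p
    have "(bch_mult nb p has_derivative (\<lambda>u. u + (1/2) *\<^sub>R nb p u)) (at 0)"
      unfolding bch_mult_def
      by (auto intro!: derivative_eq_intros simp: bilinear_lzero[OF bl])
    then show "LI u p = u + (1/2) *\<^sub>R nb p u"
      unfolding LI_def by (simp add: frechet_derivative_at[symmetric])
  qed
  have D: "frechet_derivative (LI u) (at p) = (\<lambda>w. (1/2) *\<^sub>R nb w u)" for u p
  proof -
    have "(LI u has_derivative (\<lambda>w. (1/2) *\<^sub>R nb w u)) (at p)"
      unfolding LI by (auto intro!: derivative_eq_intros simp: bilinear_rzero[OF bl])
    then show ?thesis by (simp add: frechet_derivative_at[symmetric])
  qed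
  have nil': "nb (nb x y) z = 0" for x y z using skew[of "nb x y" z] nil by simp
  show ?thesis
    unfolding transformation_bracket_def D
    unfolding LI
    using skew[of v u]
    by (simp add: bilinear_ladd[OF bl] bilinear_lmul[OF bl] nil nil' algebra_simps flip: scaleR_add_left)
qed

end

theory Submission
  imports Defs
begin

text \<open>
  Isometric automorphisms of \<open>N\<close> are linear, since \<open>h x = 2\<^sup>n h (x / 2\<^sup>n)\<close> converges to the
  derivative of \<open>h\<close> at \<open>0\<close>. So the Lie algebra of \<open>N \<rtimes> H\<^sup>a\<^sup>u\<^sup>t\<close> consists of the affine fields
  \<open>x \<mapsto> A + [A, x] / 2 + D x\<close> with \<open>D\<close> in \<open>h_aut\<close>, and the graph \<open>{A + \<xi> A}\<close> of the geodesic graph is a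
  naturally reductive complement of the isotropy algebra. Equivariance of \<open>\<xi>\<close> holds because
  faithfulness of \<open>\<pi>\<close> forces skew derivations to preserve both summands.

  A flat factor provides a function \<open>f\<close> on \<open>N\<close>, a linear coordinate on that factor, whose gradient is
  parallel and not null. In the left-invariant frame the gradient satisfies a linear differential
  equation with constant coefficients, whose integrability condition at \<open>0\<close> says that the value \<open>v\<close> of the
  gradient is orthogonal to all \<open>R(X, Y) W\<close>. For a Lorentzian data set this gives \<open>v = 0\<close>. In the degenerate
  case \<open>\<langle>\<cdot>, \<cdot>\<rangle>\<close> is positive definite on \<open>\<gg>\<close> and \<open>v\<close> is a multiple of the null vector \<open>E\<close>.
\<close>

section \<open>Calculus\<close>

text \<open>In the degenerate case the left-invariant field \<open>E\<close> is itself parallel, so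
  no curvature argument can give \<open>v = 0\<close>. The contradiction has to come from the
  length: the metric of the flat factor has a vector \<open>w\<close> with
  \<open>g0 w w \<noteq> 0\<close>, whereas every \<open>v\<close> orthogonal to the curvature turns
  out to be null. The factor \<open>M'\<close> comes with arbitrary charts and no connection.
  Instead of building one, the isometry condition is differentiated in a single chart; this
  expresses the Hessian of the flat coordinate by the metric of \<open>N\<close> alone, and all the
  rest happens on \<open>N\<close>.

  The map \<xi> is made for total skewness. The form \<open>b (nb A C) W\<close> contains one of the
  three cyclic terms of type \<open>bv (\<pi> Z X) Y\<close>; adding
  \<open>\<xi> A C - \<xi> C A\<close> supplies the other two and twice the 3-form
  \<open>bg (br _ _) _\<close>, so that the sum is alternating in \<open>A\<close>,
  \<open>C\<close>, \<open>W\<close>. This is natural reductivity.\<close>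

lemma second_difference_mean_value:
  fixes f :: "'a::real_normed_vector \<Rightarrow> real"
  assumes s: "0 < s"
    and sq: "\<And>\<alpha> \<beta>. 0 \<le> \<alpha> \<Longrightarrow> \<alpha> \<le> s \<Longrightarrow> 0 \<le> \<beta> \<Longrightarrow> \<beta> \<le> s \<Longrightarrow> p + \<alpha> *\<^sub>R u + \<beta> *\<^sub>R v \<in> S"
    and f': "\<And>x. x \<in> S \<Longrightarrow> (f has_derivative f' x) (at x)"
    and fu: "\<And>x. x \<in> S \<Longrightarrow> ((\<lambda>x. f' x u) has_derivative fu x) (at x)"
  obtains \<alpha> \<beta> where "0 < \<alpha>" "\<alpha> < s" "0 < \<beta>" "\<beta> < s"
    "f (p + s *\<^sub>R u + s *\<^sub>R v) - f (p + s *\<^sub>R u) - f (p + s *\<^sub>R v) + f p = s * s * fu (p + \<alpha> *\<^sub>R u + \<beta> *\<^sub>R v) v"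
proof -
  have lin: "f' x (c *\<^sub>R w) = c * f' x w" if "x \<in> S" for x c w
    using linear_scale[OF has_derivative_linear[OF f'[OF that]], of c w] by simp
  have lin2: "fu x (c *\<^sub>R w) = c * fu x w" if "x \<in> S" for x c w
    using linear_scale[OF has_derivative_linear[OF fu[OF that]], of c w] by simp
  \<comment> \<open>The mean value theorem is used in direction \<open>u\<close> for the increment
    along \<open>v\<close>, then in direction \<open>v\<close> for \<open>f' _ u\<close>.\<close>
  define g where "g \<alpha> = f (p + \<alpha> *\<^sub>R u + s *\<^sub>R v) - f (p + \<alpha> *\<^sub>R u)" for \<alpha>
  have in0: "p + \<alpha> *\<^sub>R u \<in> S" if "0 \<le> \<alpha>" "\<alpha> \<le> s" for \<alpha>
    using sq[OF that, of 0] s by simp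
  have "(g has_real_derivative f' (p + \<alpha> *\<^sub>R u + s *\<^sub>R v) u - f' (p + \<alpha> *\<^sub>R u) u) (at \<alpha>)"
    if \<alpha>: "0 \<le> \<alpha>" "\<alpha> \<le> s" for \<alpha>
  proof -
    have 1: "((\<lambda>\<alpha>. f (p + \<alpha> *\<^sub>R u + s *\<^sub>R v)) has_derivative (\<lambda>h. f' (p + \<alpha> *\<^sub>R u + s *\<^sub>R v) (h *\<^sub>R u))) (at \<alpha>)"
      by (rule has_derivative_compose[OF _ f']) (use sq[OF \<alpha>, of s] s in \<open>auto intro!: derivative_eq_intros\<close>)
    have 2: "((\<lambda>\<alpha>. f (p + \<alpha> *\<^sub>R u)) has_derivative (\<lambda>h. f' (p + \<alpha> *\<^sub>R u) (h *\<^sub>R u))) (at \<alpha>)"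
      by (rule has_derivative_compose[OF _ f']) (use in0[OF \<alpha>] in \<open>auto intro!: derivative_eq_intros\<close>)
    show ?thesis
      unfolding has_field_derivative_def g_def[abs_def]
      by (rule has_derivative_eq_rhs[OF has_derivative_diff[OF 1 2]])
         (use sq[OF \<alpha>, of s] s in0[OF \<alpha>] in \<open>auto simp: fun_eq_iff lin algebra_simps\<close>)
  qed
  from MVT2[OF s this]
  obtain \<alpha> where \<alpha>: "0 < \<alpha>" "\<alpha> < s"
    and g: "g s - g 0 = s * (f' (p + \<alpha> *\<^sub>R u + s *\<^sub>R v) u - f' (p + \<alpha> *\<^sub>R u) u)"
    by auto
  have "((\<lambda>\<beta>. f' (p + \<alpha> *\<^sub>R u + \<beta> *\<^sub>R v) u) has_real_derivative fu (p + \<alpha> *\<^sub>R u + \<beta> *\<^sub>R v) v) (at \<beta>)"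
    if \<beta>: "0 \<le> \<beta>" "\<beta> \<le> s" for \<beta>
  proof -
    have "((\<lambda>\<beta>. f' (p + \<alpha> *\<^sub>R u + \<beta> *\<^sub>R v) u) has_derivative (\<lambda>h. fu (p + \<alpha> *\<^sub>R u + \<beta> *\<^sub>R v) (h *\<^sub>R v))) (at \<beta>)"
      by (rule has_derivative_compose[OF _ fu]) (use sq[OF _ _ \<beta>, of \<alpha>] \<alpha> in \<open>auto intro!: derivative_eq_intros\<close>)
    then show ?thesis
      using sq[OF _ _ \<beta>, of \<alpha>] \<alpha> by (simp add: has_field_derivative_def lin2 mult_commute_abs)
  qed
  from MVT2[OF s this]
  obtain \<beta> where \<beta>: "0 < \<beta>" "\<beta> < s"
    and h: "f' (p + \<alpha> *\<^sub>R u + s *\<^sub>R v) u - f' (p + \<alpha> *\<^sub>R u) u = s * fu (p + \<alpha> *\<^sub>R u + \<beta> *\<^sub>R v) v"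
    by auto
  show thesis
    by (rule that[OF \<alpha> \<beta>]) (use g h in \<open>simp add: g_def algebra_simps\<close>)
qed

text \<open>The second difference over a small parallelogram is symmetric and equals, up to the same
  factor, either mixed derivative at a nearby point; continuity at \<open>p\<close> does the rest.
  Only directional second derivatives enter, which is what \<open>Ck_on\<close> delivers.\<close>

lemma second_derivative_symmetric_real:
  fixes f :: "'a::real_normed_vector \<Rightarrow> real"
  assumes S: "open S" "p \<in> S"
    and f': "\<And>x. x \<in> S \<Longrightarrow> (f has_derivative f' x) (at x)"
    and fu: "\<And>x. x \<in> S \<Longrightarrow> ((\<lambda>x. f' x u) has_derivative fu x) (at x)"
    and fv: "\<And>x. x \<in> S \<Longrightarrow> ((\<lambda>x. f' x v) has_derivative fv x) (at x)"
    and cu: "isCont (\<lambda>x. fu x v) p" and cv: "isCont (\<lambda>x. fv x u) p"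
  shows "fu p v = fv p u"
proof (rule ccontr)
  assume ne: "fu p v \<noteq> fv p u"
  define \<epsilon> where "\<epsilon> = \<bar>fu p v - fv p u\<bar> / 2"
  have \<epsilon>: "\<epsilon> > 0" using ne by (simp add: \<epsilon>_def)
  obtain r0 where r0: "r0 > 0" "ball p r0 \<subseteq> S" using S open_contains_ball by blast
  obtain r1 where r1: "r1 > 0" "\<And>x. dist x p < r1 \<Longrightarrow> dist (fu x v) (fu p v) < \<epsilon>"
    using cu \<epsilon> unfolding continuous_at_eps_delta by metis
  obtain r2 where r2: "r2 > 0" "\<And>x. dist x p < r2 \<Longrightarrow> dist (fv x u) (fv p u) < \<epsilon>"
    using cv \<epsilon> unfolding continuous_at_eps_delta by metis
  define r where "r = min r0 (min r1 r2)"
  have r: "r > 0" using r0 r1 r2 by (simp add: r_def)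
  \<comment> \<open>Keeps the parallelogram in the ball of radius \<open>r\<close>; the summand 1
    covers \<open>u = v = 0\<close>.\<close>
  define s where "s = r / (2 * (norm u + norm v + 1))"
  have d: "norm u + norm v + 1 > 0" by (smt (verit) norm_ge_zero)
  have s: "s > 0" using r d by (simp add: s_def)
  have sr: "s * (norm u + norm v) < r"
  proof -
    have "s * (norm u + norm v) \<le> s * (norm u + norm v + 1)" using s by (intro mult_left_mono) auto
    also have "\<dots> = r / 2" using d by (simp add: s_def field_simps)
    finally show ?thesis using r by simp
  qed
  have near: "dist (p + \<alpha> *\<^sub>R x + \<beta> *\<^sub>R y) p < r"
    if "0 \<le> \<alpha>" "\<alpha> \<le> s" "0 \<le> \<beta>" "\<beta> \<le> s" "norm x + norm y = norm u + norm v" for \<alpha> \<beta> x y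
  proof -
    have "dist (p + \<alpha> *\<^sub>R x + \<beta> *\<^sub>R y) p = norm (\<alpha> *\<^sub>R x + \<beta> *\<^sub>R y)"
      by (simp add: dist_norm algebra_simps)
    also have "\<dots> \<le> \<alpha> * norm x + \<beta> * norm y"
      using norm_triangle_ineq[of "\<alpha> *\<^sub>R x" "\<beta> *\<^sub>R y"] that by simp
    also have "\<dots> \<le> s * norm x + s * norm y"
      using that by (intro add_mono mult_right_mono) auto
    also have "\<dots> < r" using sr that by (simp flip: distrib_left)
    finally show ?thesis .
  qed
  have inS: "p + \<alpha> *\<^sub>R x + \<beta> *\<^sub>R y \<in> S"
    if "0 \<le> \<alpha>" "\<alpha> \<le> s" "0 \<le> \<beta>" "\<beta> \<le> s" "norm x + norm y = norm u + norm v" for \<alpha> \<beta> x y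
    using near[OF that] r0 by (auto simp: r_def dist_commute subset_eq)
  obtain \<alpha> \<beta> where 1: "0 < \<alpha>" "\<alpha> < s" "0 < \<beta>" "\<beta> < s"
    "f (p + s *\<^sub>R u + s *\<^sub>R v) - f (p + s *\<^sub>R u) - f (p + s *\<^sub>R v) + f p = s * s * fu (p + \<alpha> *\<^sub>R u + \<beta> *\<^sub>R v) v"
    by (rule second_difference_mean_value[OF s _ f' fu, where p = p and v = v]) (use inS in auto)
  obtain \<alpha>' \<beta>' where 2: "0 < \<alpha>'" "\<alpha>' < s" "0 < \<beta>'" "\<beta>' < s"
    "f (p + s *\<^sub>R v + s *\<^sub>R u) - f (p + s *\<^sub>R v) - f (p + s *\<^sub>R u) + f p = s * s * fv (p + \<alpha>' *\<^sub>R v + \<beta>' *\<^sub>R u) u"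
    by (rule second_difference_mean_value[OF s _ f' fv, where p = p and v = u]) (use inS in \<open>auto simp: add.commute\<close>)
  have "s * s * fu (p + \<alpha> *\<^sub>R u + \<beta> *\<^sub>R v) v = s * s * fv (p + \<alpha>' *\<^sub>R v + \<beta>' *\<^sub>R u) u"
    using 1(5) 2(5) by (simp add: algebra_simps)
  then have "fu (p + \<alpha> *\<^sub>R u + \<beta> *\<^sub>R v) v = fv (p + \<alpha>' *\<^sub>R v + \<beta>' *\<^sub>R u) u" using s by simp
  moreover have "dist (fu (p + \<alpha> *\<^sub>R u + \<beta> *\<^sub>R v) v) (fu p v) < \<epsilon>"
    using near[of \<alpha> \<beta> u v] 1 by (intro r1) (auto simp: r_def)
  moreover have "dist (fv (p + \<alpha>' *\<^sub>R v + \<beta>' *\<^sub>R u) u) (fv p u) < \<epsilon>"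
    using near[of \<alpha>' \<beta>' v u] 2 by (intro r2) (auto simp: r_def)
  ultimately show False unfolding \<epsilon>_def dist_real_def by (auto simp: abs_if split: if_splits)
qed

lemma second_derivative_symmetric:
  fixes f :: "'a::real_normed_vector \<Rightarrow> 'b::euclidean_space"
  assumes S: "open S" "p \<in> S"
    and f': "\<And>x. x \<in> S \<Longrightarrow> (f has_derivative f' x) (at x)"
    and fu: "\<And>x. x \<in> S \<Longrightarrow> ((\<lambda>x. f' x u) has_derivative fu x) (at x)"
    and fv: "\<And>x. x \<in> S \<Longrightarrow> ((\<lambda>x. f' x v) has_derivative fv x) (at x)"
    and cu: "isCont (\<lambda>x. fu x v) p" and cv: "isCont (\<lambda>x. fv x u) p"
  shows "fu p v = fv p u"
proof (rule euclidean_eqI)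
  fix i :: 'b
  show "fu p v \<bullet> i = fv p u \<bullet> i"
    by (rule second_derivative_symmetric_real[OF S, where f = "\<lambda>x. f x \<bullet> i" and f' = "\<lambda>x w. f' x w \<bullet> i"
        and fu = "\<lambda>x w. fu x w \<bullet> i" and fv = "\<lambda>x w. fv x w \<bullet> i"])
       (auto intro!: has_derivative_inner_left f' fu fv continuous_intros cu cv)
qed

lemma Ck_on_Suc_imp: "Ck_on (Suc k) f S \<Longrightarrow> Ck_on k f S"
proof (induction k arbitrary: f)
  case 0
  then show ?case
    by (auto intro!: continuous_at_imp_continuous_on differentiable_imp_continuous_within)
next
  case (Suc k)
  from Suc.prems have "\<forall>x\<in>S. f differentiable (at x)"
    "\<And>v. Ck_on (Suc k) (\<lambda>x. frechet_derivative f (at x) v) S"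
    by (simp_all only: Ck_on.simps(2)) auto
  with Suc.IH show ?case unfolding Ck_on.simps(2) by blast
qed

lemma Ck_on_UNIV_SucI:
  assumes "\<And>x. (f has_derivative f' x) (at x)" "\<And>v. Ck_on k (\<lambda>x. f' x v) UNIV"
  shows "Ck_on (Suc k) f UNIV"
proof -
  have "frechet_derivative f (at x) = f' x" for x
    using frechet_derivative_at[OF assms(1)] by simp
  then show ?thesis using assms by (auto simp: differentiable_def)
qed

lemma Ck_on_UNIV_SucD:
  assumes "Ck_on (Suc k) f UNIV"
  shows "(f has_derivative frechet_derivative f (at x)) (at x)" "Ck_on k (\<lambda>x. frechet_derivative f (at x) v) UNIV"
  using assms by (auto simp: frechet_derivative_works)

lemma Ck_on_const: "Ck_on k (\<lambda>x. c) UNIV"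
proof (induction k arbitrary: c)
  case (Suc k)
  show ?case by (rule Ck_on_UNIV_SucI[of _ "\<lambda>x v. 0"]) (auto intro: Suc)
qed simp

lemma Ck_on_linear: "linear f \<Longrightarrow> Ck_on k f UNIV"
  by (cases k)
     (auto intro!: Ck_on_UNIV_SucI[of f "\<lambda>x. f"] Ck_on_const linear_imp_has_derivative linear_continuous_on
       simp: linear_conv_bounded_linear bounded_linear_imp_has_derivative simp del: Ck_on.simps(2))

lemma Ck_on_add:
  "Ck_on k f UNIV \<Longrightarrow> Ck_on k g UNIV \<Longrightarrow> Ck_on k (\<lambda>x. f x + g x) UNIV"
proof (induction k arbitrary: f g)
  case (Suc k)
  note f = Ck_on_UNIV_SucD[OF Suc.prems(1)] and g = Ck_on_UNIV_SucD[OF Suc.prems(2)]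
  show ?case by (rule Ck_on_UNIV_SucI) (rule has_derivative_add[OF f(1) g(1)], rule Suc.IH[OF f(2) g(2)])
qed (auto intro: continuous_intros)

lemma Ck_on_sum:
  "(\<And>i. i \<in> I \<Longrightarrow> Ck_on k (f i) UNIV) \<Longrightarrow> Ck_on k (\<lambda>x. \<Sum>i\<in>I. f i x) UNIV"
  by (induction I rule: infinite_finite_induct) (auto intro: Ck_on_const Ck_on_add)

lemma Ck_on_bilinear:
  assumes B: "bounded_bilinear B"
  shows "Ck_on k f UNIV \<Longrightarrow> Ck_on k g UNIV \<Longrightarrow> Ck_on k (\<lambda>x. B (f x) (g x)) UNIV"
proof (induction k arbitrary: f g)
  case 0
  then show ?case using bounded_bilinear.continuous_on[OF B] by auto
next
  case (Suc k)
  note f = Ck_on_UNIV_SucD[OF Suc.prems(1)] and g = Ck_on_UNIV_SucD[OF Suc.prems(2)]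
  show ?case
    \<comment> \<open>The product rule leaves one factor undifferentiated, so its regularity is
      lowered from \<open>Suc k\<close> to \<open>k\<close>.\<close>
    by (rule Ck_on_UNIV_SucI, rule bounded_bilinear.FDERIV[OF B f(1) g(1)])
       (intro Ck_on_add Suc.IH f(2) g(2) Suc.prems[THEN Ck_on_Suc_imp])
qed

lemma Ck_on_linear_compose:
  assumes h: "linear h"
  shows "Ck_on k f UNIV \<Longrightarrow> Ck_on k (\<lambda>x. h (f x)) UNIV"
proof (induction k arbitrary: f)
  case 0
  then show ?case using linear_continuous_on_compose[OF _ h] by auto
next
  case (Suc k)
  note f = Ck_on_UNIV_SucD[OF Suc.prems(1)]
  show ?case
    by (rule Ck_on_UNIV_SucI, rule bounded_linear.has_derivative[OF _ f(1)])
       (use h Suc.IH f(2) in \<open>auto simp: linear_conv_bounded_linear\<close>)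
qed

section \<open>Linear ordinary differential equations\<close>

text \<open>The operator exponential of \<open>t M\<close>, as a series of vectors so that summation
  takes place in \<open>'a\<close>.\<close>

definition exp_linear :: "('a::euclidean_space \<Rightarrow> 'a) \<Rightarrow> real \<Rightarrow> 'a \<Rightarrow> 'a" where
  "exp_linear M t x = (\<Sum>n. (t ^ n / fact n) *\<^sub>R (M ^^ n) x)"

context
  fixes M :: "'a::euclidean_space \<Rightarrow> 'a"
  assumes M: "linear M"
begin

lemma linear_funpow: "linear (M ^^ n)"
  by (induction n) (auto intro: linear_compose[unfolded o_def] M simp: linear_id[unfolded id_def] id_def)

lemma exp_linear_summable: "summable (\<lambda>n. (t ^ n / fact n) *\<^sub>R (M ^^ n) x)"
proof -
  obtain K where K: "K > 0" "\<And>x. norm (M x) \<le> norm x * K"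
    using bounded_linear.pos_bounded[of M] M by (auto simp: linear_conv_bounded_linear)
  have b: "norm ((M ^^ n) x) \<le> K ^ n * norm x" for n
  proof (induction n)
    case (Suc n)
    have "norm ((M ^^ Suc n) x) \<le> norm ((M ^^ n) x) * K" using K(2) by simp
    also have "\<dots> \<le> (K ^ n * norm x) * K" using Suc K(1) by (intro mult_right_mono) auto
    finally show ?case by (simp add: algebra_simps)
  qed simp
  show ?thesis
  proof (rule summable_norm_cancel, rule summable_comparison_test')
    show "summable (\<lambda>n. ((\<bar>t\<bar> * K) ^ n /\<^sub>R fact n) * norm x)"
      by (intro summable_mult2 summable_exp_generic)
    show "norm (norm ((t ^ n / fact n) *\<^sub>R (M ^^ n) x)) \<le> ((\<bar>t\<bar> * K) ^ n /\<^sub>R fact n) * norm x" for n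
      using mult_left_mono[OF b[of n], of "\<bar>t\<bar> ^ n / fact n"]
      by (simp add: power_mult_distrib power_abs field_simps)
  qed
qed

lemma exp_linear_0: "exp_linear M 0 x = x"
proof -
  have "exp_linear M 0 x = (\<Sum>n. if n = 0 then x else 0)"
    unfolding exp_linear_def by (intro suminf_cong) auto
  then show ?thesis using suminf_finite[of "{0}" "\<lambda>n. if n = 0 then x else 0"] by simp
qed

lemma linear_exp_linear: "linear (exp_linear M t)"
proof (rule linearI)
  show "exp_linear M t (x + y) = exp_linear M t x + exp_linear M t y" for x y
    unfolding exp_linear_def
    by (simp add: linear_add[OF linear_funpow] scaleR_add_right suminf_add exp_linear_summable)
  show "exp_linear M t (c *\<^sub>R x) = c *\<^sub>R exp_linear M t x" for c x
    unfolding exp_linear_def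
    by (simp add: linear_scale[OF linear_funpow] scaleR_left_commute[of _ c] del: scaleR_scaleR
        flip: suminf_scaleR_right[OF exp_linear_summable])
qed

lemma exp_linear_commute: "M (exp_linear M t x) = exp_linear M t (M x)"
  unfolding exp_linear_def
  using bounded_linear.suminf[of M, OF _ exp_linear_summable] M
  by (simp add: linear_scale[OF M] linear_conv_bounded_linear funpow_swap1)

lemma exp_linear_has_derivative:
  "((\<lambda>t. exp_linear M t x) has_derivative (\<lambda>h. h *\<^sub>R M (exp_linear M t x))) (at t)"
proof (subst has_derivative_componentwise_within, intro ballI)
  fix i :: 'a
  define c where "c y n = ((M ^^ n) y \<bullet> i) / fact n" for y n
  have e: "exp_linear M t y \<bullet> i = (\<Sum>n. c y n * t ^ n)" and s: "summable (\<lambda>n. c y n * t ^ n)" for t y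
    using bounded_linear.suminf[OF bounded_linear_inner_left exp_linear_summable]
      bounded_linear.summable[OF bounded_linear_inner_left exp_linear_summable]
    by (simp_all add: exp_linear_def c_def mult.commute)
  \<comment> \<open>Differentiating the power series shifts its coefficients, which amounts to
    replacing \<open>x\<close> by \<open>M x\<close>.\<close>
  have d: "diffs (c x) = c (M x)"
    by (rule ext) (simp add: diffs_def c_def funpow_swap1 field_simps del: of_nat_Suc)
  have "((\<lambda>t. exp_linear M t x \<bullet> i) has_field_derivative exp_linear M t (M x) \<bullet> i) (at t)"
    unfolding e using termdiffs_strong_converges_everywhere[OF s, of x t] by (simp add: d)
  then show "((\<lambda>t. exp_linear M t x \<bullet> i) has_derivative (\<lambda>h. h *\<^sub>R M (exp_linear M t x) \<bullet> i)) (at t)"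
    by (simp add: has_field_derivative_def exp_linear_commute mult_commute_abs)
qed

text \<open>The function \<open>exp_linear M (- t) (y t)\<close> is constant: the two terms of its
  derivative cancel because \<open>M\<close> commutes with its exponential.\<close>

lemma exp_linear_ode:
  assumes y: "\<And>t. (y has_vector_derivative M (y t)) (at t)"
  shows "exp_linear M (- t) (y t) = y 0"
proof -
  \<comment> \<open>Expansion in a basis separates the time in the exponential from the time in its
    argument, so that the product rule for scalar coefficients applies.\<close>
  have rep: "exp_linear M t x = (\<Sum>i\<in>Basis. (x \<bullet> i) *\<^sub>R exp_linear M t i)" for t x
    by (subst (1) euclidean_representation[of x, symmetric])
       (simp only: linear_sum[OF linear_exp_linear] linear_scale[OF linear_exp_linear])
  have neg: "((\<lambda>t. exp_linear M (- t) i) has_vector_derivative - M (exp_linear M (- t) i)) (at t)" for i t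
    unfolding has_vector_derivative_def
    using has_derivative_compose[OF has_derivative_minus[OF has_derivative_ident] exp_linear_has_derivative]
    by simp
  define w where "w t = exp_linear M (- t) (y t)" for t
  have "(w has_vector_derivative 0) (at t)" for t
  proof -
    have c: "((\<lambda>t. y t \<bullet> i) has_real_derivative M (y t) \<bullet> i) (at t)" for i
      using has_derivative_inner_left[OF y[unfolded has_vector_derivative_def], of i]
      by (simp add: has_field_derivative_def mult_commute_abs)
    have "(w has_vector_derivative
       (\<Sum>i\<in>Basis. (y t \<bullet> i) *\<^sub>R (- M (exp_linear M (- t) i)) + (M (y t) \<bullet> i) *\<^sub>R exp_linear M (- t) i)) (at t)"
      unfolding w_def[abs_def] rep[of _ "y _"]
      by (intro has_vector_derivative_sum has_vector_derivative_scaleR neg c)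
    also have "(\<Sum>i\<in>Basis. (y t \<bullet> i) *\<^sub>R (- M (exp_linear M (- t) i)) + (M (y t) \<bullet> i) *\<^sub>R exp_linear M (- t) i)
      = exp_linear M (- t) (M (y t)) - M (exp_linear M (- t) (y t))"
      by (simp add: sum_subtractf rep[of _ "M (y t)"] rep[of _ "y t"] linear_sum[OF M] linear_scale[OF M])
    finally show ?thesis by (simp add: exp_linear_commute)
  qed
  then have "w t = w 0"
    using has_vector_derivative_zero_constant[of UNIV w] by (metis convex_UNIV UNIV_I)
  then show ?thesis by (simp add: w_def exp_linear_0)
qed

lemma exp_linear_has_vector_derivative:
  "((\<lambda>t. exp_linear M t x) has_vector_derivative M (exp_linear M t x)) (at t)"
  using exp_linear_has_derivative by (simp add: has_vector_derivative_def)

lemma exp_linear_minus_cancel: "exp_linear M (- t) (exp_linear M t x) = x"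
  using exp_linear_ode[OF exp_linear_has_vector_derivative] by (simp add: exp_linear_0)

lemma linear_ode_unique:
  assumes y: "\<And>t. (y has_vector_derivative M (y t)) (at t)"
  shows "y t = exp_linear M t (y 0)"
  using exp_linear_ode[OF y, of t] exp_linear_minus_cancel[of "- t" "y t"] by simp

lemma exp_linear_add: "exp_linear M (s + t) x = exp_linear M s (exp_linear M t x)"
proof -
  have "((\<lambda>s. exp_linear M (s + t) x) has_vector_derivative M (exp_linear M (s + t) x)) (at s)" for s
    unfolding has_vector_derivative_def
    by (rule has_derivative_compose[OF _ exp_linear_has_derivative, of "\<lambda>s. s + t"])
       (auto intro!: derivative_eq_intros)
  from linear_ode_unique[OF this, of s] show ?thesis by simp
qed

text \<open>Stated on pairs because \<open>transformation_lie_algebra\<close> asks for smoothness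
  jointly in time and point. The derivative has the same shape with \<open>M x\<close> for
  \<open>x\<close>, hence the induction over arbitrary \<open>x\<close>.\<close>

lemma Ck_on_exp_linear: "Ck_on k (\<lambda>p. exp_linear M (fst p) x) (UNIV :: (real \<times> 'b::euclidean_space) set)"
proof (induction k arbitrary: x)
  case 0
  have "continuous_on UNIV (\<lambda>t. exp_linear M t x)"
    using exp_linear_has_derivative by (intro continuous_at_imp_continuous_on) (auto intro: has_derivative_continuous)
  from continuous_on_compose2[OF this continuous_on_fst[OF continuous_on_id]] show ?case by simp
next
  case (Suc k)
  have d: "((\<lambda>p. exp_linear M (fst p) x) has_derivative (\<lambda>v. fst v *\<^sub>R M (exp_linear M (fst p) x))) (at p)"
    for p :: "real \<times> 'b"
    by (rule has_derivative_compose[OF _ exp_linear_has_derivative, of fst]) (auto intro!: derivative_eq_intros)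
  show ?case
    by (rule Ck_on_UNIV_SucI[OF d], unfold exp_linear_commute)
       (rule Ck_on_linear_compose[OF linear_scaleR Suc])
qed

end

section \<open>Isometries of vector spaces with a metric tensor\<close>

lemma smooth_on_affine: "linear T \<Longrightarrow> smooth_on (\<lambda>x. c + T x) UNIV"
  by (auto simp: smooth_on_def intro: Ck_on_add Ck_on_const Ck_on_linear)

lemma frechet_derivative_affine:
  fixes T :: "'a::euclidean_space \<Rightarrow> 'b::real_normed_vector"
  shows "linear T \<Longrightarrow> frechet_derivative (\<lambda>x. c + T x) (at x) = T"
  by (rule frechet_derivative_at[symmetric])
     (auto intro!: derivative_eq_intros bounded_linear_imp_has_derivative simp: linear_conv_bounded_linear)

lemma isometry_global_manifold_iff:
  "isometry (global_manifold g) (global_manifold g') \<phi> \<longleftrightarrow>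
     homeomorphism UNIV UNIV \<phi> (inv \<phi>) \<and> smooth_on \<phi> UNIV \<and> smooth_on (inv \<phi>) UNIV \<and>
     (\<forall>x u v. g' (\<phi> x) (frechet_derivative \<phi> (at x) u) (frechet_derivative \<phi> (at x) v) = g x u v) \<and>
     (\<forall>x u v. g (inv \<phi> x) (frechet_derivative (inv \<phi>) (at x) u) (frechet_derivative (inv \<phi>) (at x) v) = g' x u v)"
  by (auto simp: isometry_def global_manifold_def chart_isometric_def Let_def inv_id[unfolded id_def] id_def comp_def)

text \<open>One half of the isometry condition suffices: the inverse is again affine and inherits
  invariance from \<open>iso\<close> at the preimage.\<close>

lemma isometry_affine:
  fixes T :: "'a::euclidean_space \<Rightarrow> 'a"
  assumes T: "linear T" "bij T" and iso: "\<And>x u v. g (c + T x) (T u) (T v) = g x u v"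
  shows "isometry (global_manifold g) (global_manifold g) (\<lambda>x. c + T x)"
proof -
  define R where "R = inv T"
  have TR: "T (R x) = x" "R (T x) = x" for x
    using T(2) by (auto simp: R_def bij_is_surj surj_f_inv_f bij_is_inj)
  have "linear R"
  proof (rule linearI)
    show "R (x + y) = R x + R y" for x y
      using TR(2)[of "R x + R y"] by (simp add: linear_add[OF T(1)] TR)
    show "R (a *\<^sub>R x) = a *\<^sub>R R x" for a x
      using TR(2)[of "a *\<^sub>R R x"] by (simp add: linear_scale[OF T(1)] TR)
  qed
  note R = this TR
  have inv: "inv (\<lambda>x. c + T x) = (\<lambda>y. - R c + R y)"
    by (rule inv_unique_comp) (auto simp: fun_eq_iff R linear_add[OF T(1)] linear_add[OF R(1)] linear_diff[OF T(1)] linear_neg[OF T(1)])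
  have iso': "g (- R c + R y) (R u) (R v) = g y u v" for y u v
    using iso[of "- R c + R y" "R u" "R v"] by (simp add: R linear_add[OF T(1)] linear_diff[OF T(1)] linear_neg[OF T(1)])
  have "homeomorphism UNIV UNIV (\<lambda>x. c + T x) (\<lambda>y. - R c + R y)"
    by (rule homeomorphismI)
       (auto intro!: continuous_on_add continuous_on_diff continuous_on_const
          simp: R T(1) linear_continuous_on linear_add[OF T(1)] linear_add[OF R(1)] linear_diff[OF T(1)] linear_neg[OF T(1)]
          linear_conv_bounded_linear[symmetric])
  then show ?thesis
    unfolding isometry_global_manifold_iff inv
    by (simp only: smooth_on_affine frechet_derivative_affine T R(1) iso iso' simp_thms)
qed

lemma pseudo_riemannian_global_manifold:
  fixes g :: "'a::euclidean_space \<Rightarrow> 'a \<Rightarrow> 'a \<Rightarrow> real"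
  assumes "\<And>x. metric_form (g x)" "\<And>u v. smooth_on (\<lambda>x. g x u v) UNIV"
  shows "pseudo_riemannian_manifold (global_manifold g)"
proof -
  \<comment> \<open>Compatibility of the only chart with itself says that the identity is an
    isometry.\<close>
  have "isometry (global_manifold g) (global_manifold g) (\<lambda>x. 0 + x)"
    by (rule isometry_affine) (auto simp: linear_id[unfolded id_def] bij_id[unfolded id_def])
  then have "isometry (global_manifold g) (global_manifold g) id" by (simp add: id_def)
  then show ?thesis
    using assms
    by (auto simp: pseudo_riemannian_manifold_def isometry_def global_manifold_def metric_chart_ok_def inv_id
        inv_id[unfolded id_def] id_def)
qed

section \<open>The group of a 2-step nilpotent metric Lie algebra\<close>

locale two_step_metric_lie_algebra =
  fixes nb :: "'a::euclidean_space \<Rightarrow> 'a \<Rightarrow> 'a" and b :: "'a \<Rightarrow> 'a \<Rightarrow> real"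
  assumes lie: "lie_bracket nb" and nil: "\<And>x y z. nb x (nb y z) = 0" and metric: "metric_form b"
begin

lemma bilinear_nb: "bilinear nb" and nb_self [simp]: "nb x x = 0"
  using lie by (auto simp: lie_bracket_def)

lemma nb_skew: "nb x y = - nb y x"
  using nb_self[of "x + y"] nb_self[of x] nb_self[of y]
  by (simp add: bilinear_ladd[OF bilinear_nb] bilinear_radd[OF bilinear_nb] eq_neg_iff_add_eq_0 add.commute del: nb_self)

lemma nil': "nb (nb x y) z = 0"
  using nb_skew[of "nb x y" z] nil by simp

lemma bilinear_b: "bilinear b" and b_sym: "b x y = b y x" and b_nondegenerate: "(\<And>y. b x y = 0) \<Longrightarrow> x = 0"
  using metric unfolding metric_form_def by blast+

lemmas nb_simps = bilinear_ladd[OF bilinear_nb] bilinear_radd[OF bilinear_nb] bilinear_lmul[OF bilinear_nb]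
  bilinear_rmul[OF bilinear_nb] bilinear_lneg[OF bilinear_nb] bilinear_rneg[OF bilinear_nb]
  bilinear_lsub[OF bilinear_nb] bilinear_rsub[OF bilinear_nb]
  bilinear_lzero[OF bilinear_nb] bilinear_rzero[OF bilinear_nb] nil nil'

lemmas b_simps = bilinear_ladd[OF bilinear_b] bilinear_radd[OF bilinear_b] bilinear_lmul[OF bilinear_b]
  bilinear_rmul[OF bilinear_b] bilinear_lneg[OF bilinear_b] bilinear_rneg[OF bilinear_b]
  bilinear_lsub[OF bilinear_b] bilinear_rsub[OF bilinear_b]
  bilinear_lzero[OF bilinear_b] bilinear_rzero[OF bilinear_b]

lemma bounded_bilinear_nb: "bounded_bilinear nb" and bounded_bilinear_b: "bounded_bilinear b"
  using bilinear_nb bilinear_b by (simp_all add: bilinear_conv_bounded_bilinear)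

lemma linear_nb: "linear (nb x)"
  using bilinear_nb by (simp_all add: bilinear_def)

lemma linear_translation: "linear (\<lambda>x. x + c *\<^sub>R nb p x)"
  by (rule linearI) (simp_all add: nb_simps algebra_simps)

text \<open>Left translation by \<open>- p\<close> is an affine map, so its derivative is its linear
  part at every point.\<close>

lemma left_invariant_metric_eq:
  "left_invariant_metric nb b p u v = b (u - (1/2) *\<^sub>R nb p u) (v - (1/2) *\<^sub>R nb p v)"
proof -
  have "bch_mult nb (- p) = (\<lambda>x. - p + (x + (- 1/2) *\<^sub>R nb p x))"
    by (auto simp: bch_mult_def nb_simps fun_eq_iff)
  then show ?thesis
    unfolding left_invariant_metric_def by (simp only: frechet_derivative_affine[OF linear_translation]) simp
qed

lemma pseudo_riemannian_left_invariant_metric: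
  "pseudo_riemannian_manifold (global_manifold (left_invariant_metric nb b))"
proof (rule pseudo_riemannian_global_manifold)
  fix p
  show "metric_form (left_invariant_metric nb b p)"
    unfolding metric_form_def
  proof (intro conjI allI impI)
    show "bilinear (left_invariant_metric nb b p)"
      unfolding bilinear_def left_invariant_metric_eq
      by (intro conjI allI linearI) (simp_all add: nb_simps b_simps algebra_simps)
    show "left_invariant_metric nb b p x y = left_invariant_metric nb b p y x" for x y
      by (simp add: left_invariant_metric_eq b_sym)
    fix x assume "\<forall>y. left_invariant_metric nb b p x y = 0"
    then have 0: "b (x - (1/2) *\<^sub>R nb p x) (y - (1/2) *\<^sub>R nb p y) = 0" for y
      by (simp add: left_invariant_metric_eq)
    have "x - (1/2) *\<^sub>R nb p x = 0"
    proof (rule b_nondegenerate)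
      \<comment> \<open>By 2-step nilpotency, adding half the bracket with \<open>p\<close> inverts
        subtracting it.\<close>
      show "b (x - (1/2) *\<^sub>R nb p x) y = 0" for y
        using 0[of "y + (1/2) *\<^sub>R nb p y"] by (simp add: nb_simps)
    qed
    then have x: "x = (1/2) *\<^sub>R nb p x" by simp
    have "nb p x = 0" by (subst x) (simp add: nb_simps)
    with x show "x = 0" by simp
  qed
  fix u v
  have aff: "Ck_on k (\<lambda>p. w - (1/2) *\<^sub>R nb p w) UNIV" for k w
  proof -
    have "linear (\<lambda>p. (- 1/2) *\<^sub>R nb p w)" by (rule linearI) (simp_all add: nb_simps algebra_simps)
    from Ck_on_add[OF Ck_on_const Ck_on_linear[OF this], of k w] show ?thesis by simp
  qed
  show "smooth_on (\<lambda>p. left_invariant_metric nb b p u v) UNIV"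
    unfolding smooth_on_def left_invariant_metric_eq
    by (intro allI Ck_on_bilinear[OF bounded_bilinear_b] aff)
qed

lemma isometry_bch_mult:
  assumes h: "linear h" "bij h" "\<And>x y. h (nb x y) = nb (h x) (h y)" "\<And>x y. b (h x) (h y) = b x y"
  shows "isometry (global_manifold (left_invariant_metric nb b)) (global_manifold (left_invariant_metric nb b))
           (bch_mult nb p \<circ> h)"
proof -
  define T where "T x = h x + (1/2) *\<^sub>R nb p (h x)" for x
  have "bij (\<lambda>x. x + (1/2) *\<^sub>R nb p x)"
    by (rule o_bij[of "\<lambda>x. x - (1/2) *\<^sub>R nb p x"]) (auto simp: fun_eq_iff nb_simps)
  then have "bij T" using bij_comp[OF h(2)] by (simp add: T_def[abs_def] comp_def)
  moreover have "linear T"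
    using linear_compose[OF h(1) linear_translation] by (simp add: T_def[abs_def] comp_def)
  moreover have "left_invariant_metric nb b (p + T x) (T u) (T v) = left_invariant_metric nb b x u v" for x u v
  proof -
    \<comment> \<open>Pulling vectors back to the neutral element absorbs left translations and
      commutes with automorphisms.\<close>
    have "T w - (1/2) *\<^sub>R nb (p + T x) (T w) = h (w - (1/2) *\<^sub>R nb x w)" for w
      by (simp add: T_def nb_simps linear_diff[OF h(1)] linear_scale[OF h(1)] h(3) algebra_simps)
    then show ?thesis by (simp add: left_invariant_metric_eq h(4))
  qed
  ultimately have "isometry (global_manifold (left_invariant_metric nb b)) (global_manifold (left_invariant_metric nb b))
           (\<lambda>x. p + T x)"
    by (intro isometry_affine)
  also have "(\<lambda>x. p + T x) = bch_mult nb p \<circ> h" by (auto simp: T_def bch_mult_def)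
  finally show ?thesis .
qed

lemma isometric_automorphisms_iff:
  "h \<in> isometric_automorphisms nb b \<longleftrightarrow>
     linear h \<and> bij h \<and> (\<forall>x y. h (nb x y) = nb (h x) (h y)) \<and> (\<forall>x y. b (h x) (h y) = b x y)"
proof
  assume r: "linear h \<and> bij h \<and> (\<forall>x y. h (nb x y) = nb (h x) (h y)) \<and> (\<forall>x y. b (h x) (h y) = b x y)"
  have "bch_mult nb 0 \<circ> h = h" by (auto simp: bch_mult_def nb_simps)
  then have "isometry (global_manifold (left_invariant_metric nb b)) (global_manifold (left_invariant_metric nb b)) h"
    using isometry_bch_mult[of h 0] r by auto
  then show "h \<in> isometric_automorphisms nb b"
    using r by (auto simp: isometric_automorphisms_def bch_mult_def linear_add linear_scale)
next
  assume h: "h \<in> isometric_automorphisms nb b"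
  then have bij: "bij h" and hom: "\<And>p q. h (bch_mult nb p q) = bch_mult nb (h p) (h q)"
    and iso: "isometry (global_manifold (left_invariant_metric nb b)) (global_manifold (left_invariant_metric nb b)) h"
    by (auto simp: isometric_automorphisms_def)
  define h' where "h' = frechet_derivative h (at 0)"
  have "Ck_on 1 h UNIV" using iso by (simp add: isometry_global_manifold_iff smooth_on_def)
  then have h': "(h has_derivative h') (at 0)" by (simp add: h'_def frechet_derivative_works)
  \<comment> \<open>Squaring in the group is doubling because \<open>nb x x = 0\<close>; so
    \<open>h\<close> commutes with doubling before additivity is known.\<close>
  have double: "h (2 *\<^sub>R x) = 2 *\<^sub>R h x" for x
    using hom[of x x] by (simp add: bch_mult_def scaleR_2)
  have h0: "h 0 = 0" using double[of 0] by (simp add: scaleR_2)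
  have pow: "2 ^ n *\<^sub>R h ((1 / 2 ^ n) *\<^sub>R x) = h x" for n x
  proof (induction n)
    case (Suc n)
    have "2 ^ Suc n *\<^sub>R h ((1 / 2 ^ Suc n) *\<^sub>R x) = 2 ^ n *\<^sub>R h (2 *\<^sub>R (1 / 2 ^ Suc n) *\<^sub>R x)"
      unfolding double by (simp add: mult.commute)
    also have "\<dots> = h x" using Suc by simp
    finally show ?case .
  qed simp
  have hh': "h x = h' x" for x
  proof -
    have "((\<lambda>t. h (t *\<^sub>R x)) has_derivative (\<lambda>t. h' (t *\<^sub>R x))) (at 0)"
      by (rule has_derivative_compose[of "\<lambda>t. t *\<^sub>R x"]) (auto intro!: derivative_eq_intros simp: h')
    then have "((\<lambda>t. norm (h (t *\<^sub>R x) - t *\<^sub>R h' x) / norm t) \<longlongrightarrow> 0) (at 0)"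
      by (simp add: has_derivative_at h0 linear_scale[OF has_derivative_linear[OF h']])
    then have "((\<lambda>t. norm ((1 / t) *\<^sub>R h (t *\<^sub>R x) - h' x)) \<longlongrightarrow> 0) (at 0)"
    proof (rule Lim_transform_eventually)
      have "norm (h (t *\<^sub>R x) - t *\<^sub>R h' x) / norm t = norm ((1 / t) *\<^sub>R h (t *\<^sub>R x) - h' x)" if "t \<noteq> 0" for t
      proof -
        have "(1 / t) *\<^sub>R h (t *\<^sub>R x) - h' x = (1 / t) *\<^sub>R (h (t *\<^sub>R x) - t *\<^sub>R h' x)"
          using that by (simp add: scaleR_diff_right)
        then show ?thesis by simp
      qed
      then show "\<forall>\<^sub>F t in at 0. norm (h (t *\<^sub>R x) - t *\<^sub>R h' x) / norm t = norm ((1 / t) *\<^sub>R h (t *\<^sub>R x) - h' x)"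
        by (auto simp: eventually_at_filter)
    qed
    then have lim: "((\<lambda>t. (1 / t) *\<^sub>R h (t *\<^sub>R x)) \<longlongrightarrow> h' x) (at 0)"
      using Lim_null tendsto_norm_zero_iff by blast
    have "filterlim (\<lambda>n. 1 / 2 ^ n :: real) (at 0) sequentially"
      unfolding filterlim_at using LIMSEQ_divide_realpow_zero[of 2 1] by auto
    from filterlim_compose[OF lim this] have "(\<lambda>n. h x) \<longlonglongrightarrow> h' x" by (simp add: pow)
    then show ?thesis using LIMSEQ_const_iff by blast
  qed
  have lin: "linear h" using has_derivative_linear[OF h'] hh' by (metis ext)
  moreover have "h (nb x y) = nb (h x) (h y)" for x y
    using hom[of x y] by (simp add: bch_mult_def linear_add[OF lin] linear_scale[OF lin])
  moreover have "b (h x) (h y) = b x y" for x y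
  proof -
    \<comment> \<open>At \<open>0\<close> the left-invariant metric is \<open>b\<close> and
      \<open>h\<close> is its own derivative, so the isometry condition there already gives
      invariance of \<open>b\<close>.\<close>
    have "h' = h" using hh' by auto
    moreover have "left_invariant_metric nb b (h 0) (h' x) (h' y) = left_invariant_metric nb b 0 x y"
      using iso unfolding isometry_global_manifold_iff h'_def by blast
    ultimately show ?thesis by (simp add: left_invariant_metric_eq h0 nb_simps)
  qed
  ultimately show "linear h \<and> bij h \<and> (\<forall>x y. h (nb x y) = nb (h x) (h y)) \<and> (\<forall>x y. b (h x) (h y) = b x y)"
    using bij by auto
qed

section \<open>Skew derivations and the Lie algebra of the transformation group\<close>

lemma h_aut_iff:
  "D \<in> h_aut nb b \<longleftrightarrow> linear D \<and> (\<forall>x y. D (nb x y) = nb (D x) y + nb x (D y)) \<and> (\<forall>x y. b (D x) y + b x (D y) = 0)"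
  by (auto simp: h_aut_def derivations_def so_form_def)

lemma h_aut_zero: "(\<lambda>x. 0) \<in> h_aut nb b"
  by (auto simp: h_aut_iff nb_simps b_simps intro: linearI)

lemma h_aut_add: "D \<in> h_aut nb b \<Longrightarrow> E \<in> h_aut nb b \<Longrightarrow> (\<lambda>x. D x + E x) \<in> h_aut nb b"
  unfolding h_aut_iff by (auto simp: nb_simps b_simps linear_compose_add algebra_simps)

lemma h_aut_scaleR: "D \<in> h_aut nb b \<Longrightarrow> (\<lambda>x. c *\<^sub>R D x) \<in> h_aut nb b"
  unfolding h_aut_iff
  by (auto simp: nb_simps b_simps linear_compose_scale_right algebra_simps simp flip: distrib_left)

lemma h_aut_commutator:
  assumes D: "D \<in> h_aut nb b" and E: "E \<in> h_aut nb b"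
  shows "commutator D E \<in> h_aut nb b"
proof -
  have lin: "linear D" "linear E" and der: "\<And>x y. D (nb x y) = nb (D x) y + nb x (D y)"
    "\<And>x y. E (nb x y) = nb (E x) y + nb x (E y)"
    and so: "\<And>x y. b (D x) y = - b x (D y)" "\<And>x y. b (E x) y = - b x (E y)"
    using D E by (auto simp: h_aut_iff eq_neg_iff_add_eq_0)
  have "linear (commutator D E)"
    using linear_compose_sub[OF linear_compose[OF lin(2,1)] linear_compose[OF lin]]
    by (simp add: commutator_def[abs_def] o_def)
  moreover have "commutator D E (nb x y) = nb (commutator D E x) y + nb x (commutator D E y)" for x y
    by (simp add: commutator_def der linear_add[OF lin(1)] linear_add[OF lin(2)] nb_simps)
  moreover have "b (commutator D E x) y + b x (commutator D E y) = 0" for x y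
    by (simp add: commutator_def so b_simps)
  ultimately show ?thesis unfolding h_aut_iff by blast
qed

text \<open>The field generated by the element \<open>A + D\<close> of the semidirect product. The
  part without \<open>D\<close> is the right-invariant field with value \<open>A\<close> at
  \<open>0\<close>, which generates left translations.\<close>

definition affine_field :: "'a \<Rightarrow> ('a \<Rightarrow> 'a) \<Rightarrow> 'a \<Rightarrow> 'a" where
  "affine_field A D = (\<lambda>x. A + (1/2) *\<^sub>R nb A x + D x)"

lemma affine_field_0: "D \<in> h_aut nb b \<Longrightarrow> affine_field A D 0 = A"
  by (simp add: affine_field_def nb_simps h_aut_iff linear_0)

text \<open>The derivation rule makes both sides of the automorphism identity solve
  \<open>y' = D y\<close> with the same initial value; skewness makes the inner products constant in
  time.\<close>

lemma exp_linear_h_aut: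
  assumes D: "D \<in> h_aut nb b"
  shows "exp_linear D t \<in> isometric_automorphisms nb b"
proof -
  have lin: "linear D" and der: "\<And>x y. D (nb x y) = nb (D x) y + nb x (D y)"
    and so: "\<And>x y. b (D x) y + b x (D y) = 0"
    using D by (auto simp: h_aut_iff)
  note d = exp_linear_has_vector_derivative[OF lin]
  have "bij (exp_linear D t)"
    by (rule o_bij[of "exp_linear D (- t)"])
       (use exp_linear_minus_cancel[OF lin, of t] exp_linear_minus_cancel[OF lin, of "- t"] in \<open>auto simp: fun_eq_iff\<close>)
  moreover have "exp_linear D t (nb x y) = nb (exp_linear D t x) (exp_linear D t y)" for x y
  proof -
    have "((\<lambda>t. nb (exp_linear D t x) (exp_linear D t y)) has_vector_derivative
        D (nb (exp_linear D t x) (exp_linear D t y))) (at t)" for t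
      using bounded_bilinear.has_vector_derivative[OF bounded_bilinear_nb d d] by (simp add: der add.commute)
    from linear_ode_unique[OF lin this, of t] show ?thesis by (simp add: exp_linear_0[OF lin])
  qed
  moreover have "b (exp_linear D t x) (exp_linear D t y) = b x y" for x y
  proof -
    have "((\<lambda>t. b (exp_linear D t x) (exp_linear D t y)) has_vector_derivative 0) (at t)" for t
      using bounded_bilinear.has_vector_derivative[OF bounded_bilinear_b d[of x t] d[of y t]]
      by (simp add: add.commute[of "b (exp_linear D t x) (D (exp_linear D t y))"] so)
    then have "b (exp_linear D t x) (exp_linear D t y) = b (exp_linear D 0 x) (exp_linear D 0 y)"
      using has_vector_derivative_zero_constant[of UNIV "\<lambda>t. b (exp_linear D t x) (exp_linear D t y)"]
      by (metis convex_UNIV UNIV_I)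
    then show ?thesis by (simp add: exp_linear_0[OF lin])
  qed
  ultimately show ?thesis by (simp add: isometric_automorphisms_iff linear_exp_linear[OF lin])
qed

text \<open>
  The flow of an affine field is the first component of the flow of a linear field on \<open>'a \<times> real\<close>,
  restricted to the hyperplane where the second component is \<open>1\<close>.
\<close>

lemma affine_field_in_transformation_lie_algebra:
  assumes D: "D \<in> h_aut nb b"
  shows "affine_field A D \<in> transformation_lie_algebra (Iso_aut nb b)"
proof -
  have lin: "linear D" and der: "\<And>x y. D (nb x y) = nb (D x) y + nb x (D y)"
    using D by (auto simp: h_aut_iff)
  define M where "M = (\<lambda>z :: 'a \<times> real. ((1/2) *\<^sub>R nb A (fst z) + D (fst z) + snd z *\<^sub>R A, 0 :: real))"
  have M: "linear M"
    by (rule linearI)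
       (simp_all add: M_def nb_simps linear_add[OF lin] linear_scale[OF lin] algebra_simps)
  have M1: "M (x, 1) = (affine_field A D x, 0)" for x
    by (simp add: M_def affine_field_def)
  define \<gamma> where "\<gamma> t x = fst (exp_linear M t (x, 1))" for t x
  have snd1: "snd (exp_linear M t (x, 1)) = 1" for t x
  proof -
    have "((\<lambda>t. snd (exp_linear M t (x, 1))) has_vector_derivative 0) (at t)" for t
      using bounded_linear.has_vector_derivative[OF bounded_linear_snd exp_linear_has_vector_derivative[OF M, of "(x, 1)" t]]
      by (simp add: M_def)
    then have "snd (exp_linear M t (x, 1)) = snd (exp_linear M 0 (x, 1))"
      using has_vector_derivative_zero_constant[of UNIV "\<lambda>t. snd (exp_linear M t (x, 1))"]
      by (metis convex_UNIV UNIV_I)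
    then show ?thesis by (simp add: exp_linear_0[OF M])
  qed
  then have \<gamma>: "exp_linear M t (x, 1) = (\<gamma> t x, 1)" for t x
    by (simp add: \<gamma>_def prod_eq_iff)
  have d\<gamma>: "((\<lambda>t. \<gamma> t x) has_vector_derivative affine_field A D (\<gamma> t x)) (at t)" for t x
    using bounded_linear.has_vector_derivative[OF bounded_linear_fst exp_linear_has_vector_derivative[OF M, of "(x, 1)" t]]
    by (simp add: \<gamma> M1)
  have \<gamma>0: "\<gamma> 0 x = x" for x by (simp add: \<gamma>_def exp_linear_0[OF M])
  \<comment> \<open>The translation part is the orbit of \<open>0\<close>, the automorphism part the
    flow of \<open>D\<close>. Their product solves the equation of \<gamma> with the same initial
    value.\<close>
  have "\<gamma> t = bch_mult nb (\<gamma> t 0) \<circ> exp_linear D t" for t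
  proof
    fix x
    let ?p = "\<lambda>t. \<gamma> t 0" and ?h = "\<lambda>t. exp_linear D t x"
    let ?y = "\<lambda>t. bch_mult nb (?p t) (?h t)"
    have "(?y has_vector_derivative affine_field A D (?y t)) (at t)" for t
    proof -
      have "(?y has_vector_derivative affine_field A D (?p t) + D (?h t)
          + (1/2) *\<^sub>R (nb (?p t) (D (?h t)) + nb (affine_field A D (?p t)) (?h t))) (at t)"
        unfolding bch_mult_def
        by (intro has_vector_derivative_add d\<gamma> exp_linear_has_vector_derivative[OF lin]
            bounded_linear.has_vector_derivative[OF bounded_linear_scaleR_right]
            bounded_bilinear.has_vector_derivative[OF bounded_bilinear_nb])
      also have "affine_field A D (?p t) + D (?h t)
          + (1/2) *\<^sub>R (nb (?p t) (D (?h t)) + nb (affine_field A D (?p t)) (?h t)) = affine_field A D (?y t)"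
        by (simp add: affine_field_def bch_mult_def nb_simps linear_add[OF lin] linear_scale[OF lin] der algebra_simps)
      finally show ?thesis .
    qed
    \<comment> \<open>The constant component \<open>1\<close> turns the affine equation into the
      linear one for \<open>M\<close>, for which solutions are unique.\<close>
    then have "((\<lambda>t. (?y t, 1 :: real)) has_vector_derivative M (?y t, 1)) (at t)" for t
      unfolding M1 by (intro has_vector_derivative_Pair has_vector_derivative_const)
    from linear_ode_unique[OF M this, of t] show "\<gamma> t x = (bch_mult nb (\<gamma> t 0) \<circ> exp_linear D t) x"
      by (simp add: exp_linear_0[OF lin] exp_linear_0[OF M] \<gamma>0 \<gamma> bch_mult_def nb_simps)
  qed
  then have "\<forall>t. \<gamma> t \<in> Iso_aut nb b"
    unfolding Iso_aut_def using exp_linear_h_aut[OF D] by blast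
  moreover have "\<forall>s t. \<gamma> (s + t) = \<gamma> s \<circ> \<gamma> t"
    using exp_linear_add[OF M, of _ _ "(_, 1)"] by (simp add: \<gamma> fun_eq_iff)
  moreover have "smooth_on (\<lambda>(t, x). \<gamma> t x) UNIV"
    unfolding smooth_on_def
  proof
    fix k
    \<comment> \<open>Separates the dependence on \<open>t\<close> from that on \<open>x\<close>: a
      sum of products of affine functions of \<open>x\<close> and exponentials in
      \<open>t\<close>.\<close>
    have "\<gamma> t x = (\<Sum>i\<in>Basis. ((x, 1) \<bullet> i) *\<^sub>R fst (exp_linear M t i))" for t x
      unfolding \<gamma>_def
      by (subst euclidean_representation[of "(x, 1)", symmetric])
         (simp only: linear_sum[OF linear_exp_linear[OF M]] linear_scale[OF linear_exp_linear[OF M]] fst_sum fst_scaleR)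
    then have eq: "(\<lambda>(t, x). \<gamma> t x) = (\<lambda>p. \<Sum>i\<in>Basis. (fst i \<bullet> snd p + snd i) *\<^sub>R fst (exp_linear M (fst p) i))"
      by (auto simp: fun_eq_iff inner_prod_def inner_commute)
    have "Ck_on k (\<lambda>p :: real \<times> 'a. fst i \<bullet> snd p + snd i) UNIV" for i :: "'a \<times> real"
      by (intro Ck_on_add Ck_on_const Ck_on_linear linearI) (auto simp: inner_right_distrib)
    then show "Ck_on k (\<lambda>(t, x). \<gamma> t x) UNIV"
      unfolding eq
      by (intro Ck_on_sum Ck_on_bilinear[OF bounded_bilinear_scaleR] Ck_on_linear_compose[OF linear_fst] Ck_on_exp_linear[OF M])
  qed
  moreover have "\<forall>x. ((\<lambda>t. \<gamma> t x) has_vector_derivative affine_field A D x) (at 0)"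
    using d\<gamma>[where t = 0] by (simp add: \<gamma>0)
  ultimately show ?thesis unfolding transformation_lie_algebra_def by blast
qed

text \<open>For the inclusion from left to right, dividing \<gamma> by its orbit of \<open>0\<close>
  leaves a curve \<open>h\<close> of isometric automorphisms through the identity; differentiating
  their defining identities at time 0 puts its velocity into \<open>h_aut\<close>.\<close>

lemma transformation_lie_algebra_Iso_aut:
  "transformation_lie_algebra (Iso_aut nb b) = {affine_field A D | A D. D \<in> h_aut nb b}"
proof (intro set_eqI iffI)
  fix U assume "U \<in> transformation_lie_algebra (Iso_aut nb b)"
  then obtain \<gamma> where G: "\<And>t. \<gamma> t \<in> Iso_aut nb b" and add: "\<And>s t. \<gamma> (s + t) = \<gamma> s \<circ> \<gamma> t"
    and d: "\<And>x. ((\<lambda>t. \<gamma> t x) has_vector_derivative U x) (at (0::real))"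
    by (auto simp: transformation_lie_algebra_def)
  define h where "h t x = bch_mult nb (- \<gamma> t 0) (\<gamma> t x)" for t x
  have h: "h t \<in> isometric_automorphisms nb b" for t
  proof -
    obtain p k where g: "\<gamma> t = bch_mult nb p \<circ> k" and k: "k \<in> isometric_automorphisms nb b"
      using G[of t] by (auto simp: Iso_aut_def)
    have "\<gamma> t 0 = p" using k by (simp add: g bch_mult_def isometric_automorphisms_iff linear_0 nb_simps)
    then have "h t x = k x" for x
      using bch_mult_group(1)[OF lie nil, of "- p" p "k x"] bch_mult_group(2,5)[OF lie nil]
      by (simp add: h_def g)
    then have "h t = k" by auto
    with k show ?thesis by simp
  qed
  then have lin: "linear (h t)" and aut: "h t (nb x y) = nb (h t x) (h t y)" and iso: "b (h t x) (h t y) = b x y" for t x y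
    by (auto simp: isometric_automorphisms_iff)
  \<comment> \<open>The map \<open>\<gamma> 0\<close> is idempotent by the group law and injective
    as an element of the group.\<close>
  have \<gamma>0: "\<gamma> 0 x = x" for x
  proof -
    obtain p k where g: "\<gamma> 0 = bch_mult nb p \<circ> k" and k: "k \<in> isometric_automorphisms nb b"
      using G[of 0] by (auto simp: Iso_aut_def)
    have "inj (bch_mult nb p)"
      by (rule inj_on_inverseI[of _ "bch_mult nb (- p)"])
         (metis bch_mult_group(1,2,5)[OF lie nil])
    then have "inj (\<gamma> 0)" unfolding g using k by (auto simp: isometric_automorphisms_iff intro: inj_compose bij_is_inj)
    moreover have "\<gamma> 0 (\<gamma> 0 x) = \<gamma> 0 x" using add[of 0 0] by (metis add_0 comp_apply)
    ultimately show ?thesis by (simp add: inj_eq)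
  qed
  \<comment> \<open>What remains of \<open>U\<close> after removing the right-invariant field with
    the same value at \<open>0\<close>.\<close>
  define D where "D x = U x - U 0 - (1/2) *\<^sub>R nb (U 0) x" for x
  have dh: "((\<lambda>t. h t x) has_vector_derivative D x) (at 0)" for x
  proof -
    have "((\<lambda>t. h t x) has_vector_derivative - U 0 + U x
       + (1/2) *\<^sub>R (nb (- \<gamma> 0 0) (U x) + nb (- U 0) (\<gamma> 0 x))) (at 0)"
      unfolding h_def bch_mult_def
      by (intro has_vector_derivative_add has_vector_derivative_minus d
          bounded_linear.has_vector_derivative[OF bounded_linear_scaleR_right]
          bounded_bilinear.has_vector_derivative[OF bounded_bilinear_nb])
    then show ?thesis by (simp add: D_def \<gamma>0 nb_simps)
  qed
  have h0: "h 0 x = x" for x by (simp add: h_def \<gamma>0 bch_mult_def nb_simps)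
  have "linear D"
  proof (rule linearI)
    fix x y c
    have "((\<lambda>t. h t (x + y)) has_vector_derivative D x + D y) (at 0)"
      unfolding linear_add[OF lin] by (intro has_vector_derivative_add dh)
    then show "D (x + y) = D x + D y" using dh vector_derivative_unique_at by blast
    have "((\<lambda>t. h t (c *\<^sub>R x)) has_vector_derivative c *\<^sub>R D x) (at 0)"
      unfolding linear_scale[OF lin]
      by (intro bounded_linear.has_vector_derivative[OF bounded_linear_scaleR_right] dh)
    then show "D (c *\<^sub>R x) = c *\<^sub>R D x" using dh vector_derivative_unique_at by blast
  qed
  moreover have "D (nb x y) = nb (D x) y + nb x (D y)" for x y
  proof -
    have "((\<lambda>t. h t (nb x y)) has_vector_derivative nb (h 0 x) (D y) + nb (D x) (h 0 y)) (at 0)"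
      unfolding aut by (intro bounded_bilinear.has_vector_derivative[OF bounded_bilinear_nb] dh)
    then have "D (nb x y) = nb (h 0 x) (D y) + nb (D x) (h 0 y)" using dh vector_derivative_unique_at by blast
    then show ?thesis by (simp add: h0 add.commute)
  qed
  moreover have "b (D x) y + b x (D y) = 0" for x y
  proof -
    have "((\<lambda>t. b (h t x) (h t y)) has_vector_derivative b (h 0 x) (D y) + b (D x) (h 0 y)) (at 0)"
      by (intro bounded_bilinear.has_vector_derivative[OF bounded_bilinear_b] dh)
    then have "b (h 0 x) (D y) + b (D x) (h 0 y) = 0"
      unfolding iso using has_vector_derivative_const vector_derivative_unique_at by blast
    then show ?thesis by (simp add: h0 add.commute)
  qed
  ultimately have "D \<in> h_aut nb b" by (simp add: h_aut_iff)
  moreover have "U = affine_field (U 0) D" by (auto simp: affine_field_def D_def)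
  ultimately show "U \<in> {affine_field A D | A D. D \<in> h_aut nb b}" by blast
qed (auto intro: affine_field_in_transformation_lie_algebra)

text \<open>The fields reproduce \<open>semidirect_bracket\<close>, sign included; all iterated
  brackets drop out by nilpotency.\<close>

lemma transformation_bracket_affine_field:
  assumes D: "D \<in> h_aut nb b" and E: "E \<in> h_aut nb b"
  shows "transformation_bracket (affine_field A D) (affine_field C E) =
    affine_field (nb A C + D C - E A) (commutator D E)"
proof
  fix x
  have lin: "linear D" "linear E" and der: "\<And>x y. D (nb x y) = nb (D x) y + nb x (D y)"
    "\<And>x y. E (nb x y) = nb (E x) y + nb x (E y)"
    using D E by (auto simp: h_aut_iff)
  have fd: "frechet_derivative (affine_field A D) (at x) = (\<lambda>v. (1/2) *\<^sub>R nb A v + D v)" if "linear D" for A D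
  proof -
    have "linear (\<lambda>v. (1/2) *\<^sub>R nb A v + D v)"
      by (intro linear_compose_add linear_compose_scale_right linear_nb that)
    from frechet_derivative_affine[OF this, of A x] show ?thesis by (simp add: affine_field_def add.assoc)
  qed
  show "transformation_bracket (affine_field A D) (affine_field C E) x =
    affine_field (nb A C + D C - E A) (commutator D E) x"
    unfolding transformation_bracket_def fd[OF lin(1)] fd[OF lin(2)]
    using nb_skew[of C A] nb_skew[of C "D x"] nb_skew[of "E A" x] nb_skew[of "E x" A]
    by (simp add: affine_field_def commutator_def nb_simps linear_add[OF lin(1)] linear_add[OF lin(2)]
        linear_scale[OF lin(1)] linear_scale[OF lin(2)] der algebra_simps flip: scaleR_add_left)
qed

text \<open>Closure rests on moving an automorphism past a translation:
  \<open>h \<circ> bch_mult nb p = bch_mult nb (h p) \<circ> h\<close>.\<close>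

lemma group_Iso_aut:
  shows "id \<in> Iso_aut nb b"
    and "\<phi> \<in> Iso_aut nb b \<Longrightarrow> \<psi> \<in> Iso_aut nb b \<Longrightarrow> \<phi> \<circ> \<psi> \<in> Iso_aut nb b"
    and "\<phi> \<in> Iso_aut nb b \<Longrightarrow> inv \<phi> \<in> Iso_aut nb b"
    and "bch_mult nb p \<in> Iso_aut nb b"
proof -
  note grp = bch_mult_group[OF lie nil]
  have id: "id \<in> isometric_automorphisms nb b"
    by (simp add: isometric_automorphisms_iff linear_id)
  show L: "bch_mult nb p \<in> Iso_aut nb b" for p
    unfolding Iso_aut_def using id by (intro CollectI exI[of _ p] exI[of _ id]) simp
  have "bch_mult nb 0 = id" using grp(2) by auto
  with L[of 0] show "id \<in> Iso_aut nb b" by simp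
  have comp: "h \<circ> k \<in> isometric_automorphisms nb b"
    if "h \<in> isometric_automorphisms nb b" "k \<in> isometric_automorphisms nb b" for h k
    using that by (auto simp: isometric_automorphisms_iff linear_compose bij_comp)
  have hom: "h \<circ> bch_mult nb p = bch_mult nb (h p) \<circ> h" if "h \<in> isometric_automorphisms nb b" for h p
    using that by (auto simp: isometric_automorphisms_def)
  show "\<phi> \<circ> \<psi> \<in> Iso_aut nb b" if G: "\<phi> \<in> Iso_aut nb b" "\<psi> \<in> Iso_aut nb b" for \<phi> \<psi>
  proof -
    obtain p h q k where \<phi>: "\<phi> = bch_mult nb p \<circ> h" "h \<in> isometric_automorphisms nb b"
      and \<psi>: "\<psi> = bch_mult nb q \<circ> k" "k \<in> isometric_automorphisms nb b"
      using G by (auto simp: Iso_aut_def)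
    have "\<phi> \<circ> \<psi> = bch_mult nb (bch_mult nb p (h q)) \<circ> (h \<circ> k)"
      using fun_cong[OF hom[OF \<phi>(2), of q]] by (auto simp: \<phi>(1) \<psi>(1) fun_eq_iff grp(1))
    then show ?thesis unfolding Iso_aut_def using comp[OF \<phi>(2) \<psi>(2)] by blast
  qed
  show "inv \<phi> \<in> Iso_aut nb b" if G: "\<phi> \<in> Iso_aut nb b" for \<phi>
  proof -
    obtain p h where \<phi>: "\<phi> = bch_mult nb p \<circ> h" and h: "h \<in> isometric_automorphisms nb b"
      using G by (auto simp: Iso_aut_def)
    have h': "linear h" "bij h" "\<And>x y. h (nb x y) = nb (h x) (h y)" "\<And>x y. b (h x) (h y) = b x y"
      using h by (auto simp: isometric_automorphisms_iff)
    define k where "k = inv h"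
    have k: "h (k x) = x" "k (h x) = x" for x
      using h'(2) by (auto simp: k_def bij_is_surj surj_f_inv_f bij_is_inj)
    have "linear k"
    proof (rule linearI)
      show "k (x + y) = k x + k y" for x y
        using k(2)[of "k x + k y"] by (simp add: linear_add[OF h'(1)] k)
      show "k (a *\<^sub>R x) = a *\<^sub>R k x" for a x
        using k(2)[of "a *\<^sub>R k x"] by (simp add: linear_scale[OF h'(1)] k)
    qed
    moreover have "bij k" using h'(2) by (simp add: k_def bij_imp_bij_inv)
    moreover have "k (nb x y) = nb (k x) (k y)" for x y
      using k(2)[of "nb (k x) (k y)"] by (simp add: h'(3) k)
    moreover have "b (k x) (k y) = b x y" for x y
      using h'(4)[of "k x" "k y"] by (simp add: k)
    ultimately have kin: "k \<in> isometric_automorphisms nb b" by (simp add: isometric_automorphisms_iff)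
    have "inv \<phi> = k \<circ> bch_mult nb (- p)"
    proof (rule inv_unique_comp)
      show "\<phi> \<circ> (k \<circ> bch_mult nb (- p)) = id"
        by (auto simp: \<phi> fun_eq_iff k grp(2,4) simp flip: grp(1))
      show "(k \<circ> bch_mult nb (- p)) \<circ> \<phi> = id"
        by (auto simp: \<phi> fun_eq_iff k grp(2,5) simp flip: grp(1))
    qed
    then show ?thesis unfolding Iso_aut_def using hom[OF kin] kin by auto
  qed
qed

text \<open>The graph of \<xi> is the complement \<open>m\<close>: equivariance makes it invariant
  under the isotropy algebra. At \<open>0\<close> the \<open>m\<close>-component of the bracket of
  \<open>A + \<xi> A\<close> and \<open>C + \<xi> C\<close> has the value
  \<open>nb A C + \<xi> A C - \<xi> C A\<close>, so \<open>red\<close> is the metric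
  condition.\<close>

theorem naturally_reductive_Iso_aut:
  assumes xi: "linear_into_h_aut nb b \<xi>" and equiv: "h_aut_equivariant nb b \<xi>"
    and red: "\<And>A C W. b (nb A C + \<xi> A C - \<xi> C A) W + b C (nb A W + \<xi> A W - \<xi> W A) = 0"
  shows "naturally_reductive (left_invariant_metric nb b) (Iso_aut nb b) 0"
proof -
  have \<xi>: "\<xi> A \<in> h_aut nb b" for A using xi by (simp add: linear_into_h_aut_def)
  have lin\<xi>: "linear (\<lambda>A. \<xi> A x)" for x using xi by (simp add: linear_into_h_aut_def)
  let ?L = "transformation_lie_algebra (Iso_aut nb b)"
  define k where "k = {U \<in> ?L. U 0 = 0}"
  define m where "m = range (\<lambda>A. affine_field A (\<xi> A))"
  have L: "?L = {affine_field A D | A D. D \<in> h_aut nb b}" by (rule transformation_lie_algebra_Iso_aut)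
  have k: "k = {affine_field 0 D | D. D \<in> h_aut nb b}"
    unfolding k_def L by (auto simp: affine_field_0)
  have f0: "affine_field 0 D = D" for D by (auto simp: affine_field_def nb_simps)
  \<comment> \<open>A field with zero translation part is the linear map \<open>D\<close> itself, so
    the isotropy algebra equals \<open>h_aut\<close> as a set of maps.\<close>
  have k': "k = h_aut nb b" unfolding k f0 by simp
  have add: "(\<lambda>x. affine_field A D x + affine_field C E x) = affine_field (A + C) (\<lambda>x. D x + E x)" for A D C E
    by (auto simp: affine_field_def nb_simps algebra_simps)
  have scale: "(\<lambda>x. c *\<^sub>R affine_field A D x) = affine_field (c *\<^sub>R A) (\<lambda>x. c *\<^sub>R D x)" for c A D
    by (auto simp: affine_field_def nb_simps algebra_simps)
  have zero: "(\<lambda>x. 0) = affine_field 0 (\<lambda>x. 0)" by (simp add: f0)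
  have subL: "vf_subspace ?L"
    unfolding vf_subspace_def L
    by (auto simp: add scale) (metis zero h_aut_zero, metis h_aut_add, metis h_aut_scaleR)
  have subk: "vf_subspace k"
    unfolding vf_subspace_def k' by (auto intro: h_aut_zero h_aut_add h_aut_scaleR)
  have mI: "affine_field A (\<xi> A) \<in> m" for A by (simp add: m_def)
  have subm: "vf_subspace m"
    unfolding vf_subspace_def
  proof (intro conjI ballI allI)
    have "\<xi> 0 = (\<lambda>x. 0)" using linear_0[OF lin\<xi>] by auto
    then show "(\<lambda>x. 0) \<in> m" using mI[of 0] by (simp add: f0)
  next
    fix U V assume "U \<in> m" "V \<in> m"
    then obtain A C where U: "U = affine_field A (\<xi> A)" and V: "V = affine_field C (\<xi> C)" by (auto simp: m_def)
    have "\<xi> (A + C) = (\<lambda>x. \<xi> A x + \<xi> C x)" using linear_add[OF lin\<xi>] by auto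
    then show "(\<lambda>x. U x + V x) \<in> m" using mI[of "A + C"] unfolding U V add by simp
  next
    fix U c assume "U \<in> m"
    then obtain A where U: "U = affine_field A (\<xi> A)" by (auto simp: m_def)
    have "\<xi> (c *\<^sub>R A) = (\<lambda>x. c *\<^sub>R \<xi> A x)" using linear_scale[OF lin\<xi>] by auto
    then show "(\<lambda>x. c *\<^sub>R U x) \<in> m" using mI[of "c *\<^sub>R A"] unfolding U scale by simp
  qed
  have km: "k \<inter> m = {\<lambda>x. 0}"
  proof -
    have "U = (\<lambda>x. 0)" if "U \<in> k" "U \<in> m" for U
    proof -
      from that(2) obtain A where A: "U = affine_field A (\<xi> A)" by (auto simp: m_def)
      with that(1) have "A = 0" using affine_field_0[OF \<xi>] by (simp add: k_def)
      then show ?thesis using linear_0[OF lin\<xi>] by (auto simp: A f0)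
    qed
    then show ?thesis using subk subm by (auto simp: vf_subspace_def)
  qed
  have diff: "(\<lambda>x. affine_field A D x - affine_field A E x) = (\<lambda>x. D x + (-1) *\<^sub>R E x)" for A D E
    by (auto simp: affine_field_def)
  have sum: "?L = {\<lambda>x. K x + U x | K U. K \<in> k \<and> U \<in> m}"
  proof (intro set_eqI iffI)
    fix U assume "U \<in> ?L"
    then obtain A D where U: "U = affine_field A D" and D: "D \<in> h_aut nb b" by (auto simp: L)
    have "U = (\<lambda>x. (D x + (-1) *\<^sub>R \<xi> A x) + affine_field A (\<xi> A) x)"
      by (auto simp: U affine_field_def)
    moreover have "(\<lambda>x. D x + (-1) *\<^sub>R \<xi> A x) \<in> k"
      unfolding k' by (intro h_aut_add h_aut_scaleR D \<xi>)
    ultimately show "U \<in> {\<lambda>x. K x + U x | K U. K \<in> k \<and> U \<in> m}"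
      by (intro CollectI exI[of _ "\<lambda>x. D x + (-1) *\<^sub>R \<xi> A x"] exI[of _ "affine_field A (\<xi> A)"] conjI mI)
  next
    fix U assume "U \<in> {\<lambda>x. K x + U x | K U. K \<in> k \<and> U \<in> m}"
    then obtain K A where U: "U = (\<lambda>x. K x + affine_field A (\<xi> A) x)" and "K \<in> k" by (auto simp: m_def)
    then have K: "K \<in> h_aut nb b" by (simp add: k')
    have "U = affine_field A (\<lambda>x. K x + \<xi> A x)" using add[of 0 K A "\<xi> A"] by (simp add: U f0)
    then show "U \<in> ?L" unfolding L using h_aut_add[OF K \<xi>] by blast
  qed
  \<comment> \<open>Fields in \<open>k\<close> vanish at \<open>0\<close>, so passing to the
    \<open>m\<close>-component does not change the value there.\<close>
  have component: "vf_component k m (affine_field A D) 0 = A" if D: "D \<in> h_aut nb b" for A D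
  proof -
    have "vf_component k m (affine_field A D) = affine_field A (\<xi> A)"
      unfolding vf_component_def
    proof (rule the_equality)
      show "affine_field A (\<xi> A) \<in> m \<and> (\<lambda>x. affine_field A D x - affine_field A (\<xi> A) x) \<in> k"
        unfolding diff k' by (intro conjI mI h_aut_add h_aut_scaleR D \<xi>)
      fix P assume P: "P \<in> m \<and> (\<lambda>x. affine_field A D x - P x) \<in> k"
      then obtain C where C: "P = affine_field C (\<xi> C)" by (auto simp: m_def)
      have "affine_field A D 0 - P 0 = 0" using P by (simp add: k_def)
      then show "P = affine_field A (\<xi> A)" by (simp add: C affine_field_0 D \<xi>)
    qed
    then show ?thesis by (simp add: affine_field_0 \<xi>)
  qed
  have inv: "transformation_bracket K U \<in> m" if K: "K \<in> k" and U: "U \<in> m" for K U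
  proof -
    obtain A where A: "U = affine_field A (\<xi> A)" using U by (auto simp: m_def)
    have K': "K \<in> h_aut nb b" using K by (simp add: k')
    have "transformation_bracket K U = affine_field (K A) (commutator K (\<xi> A))"
      using transformation_bracket_affine_field[OF K' \<xi>, of 0 A A] \<xi>[of A]
      by (simp add: f0 A nb_simps h_aut_iff linear_0)
    also have "commutator K (\<xi> A) = \<xi> (K A)" using equiv K' by (simp add: h_aut_equivariant_def)
    finally show ?thesis by (simp add: m_def)
  qed
  have nr: "left_invariant_metric nb b 0 (vf_component k m (transformation_bracket U V) 0) (W 0) +
      left_invariant_metric nb b 0 (V 0) (vf_component k m (transformation_bracket U W) 0) = 0"
    if UVW: "U \<in> m" "V \<in> m" "W \<in> m" for U V W
  proof -
    obtain A C E where "U = affine_field A (\<xi> A)" "V = affine_field C (\<xi> C)" "W = affine_field E (\<xi> E)"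
      using UVW by (auto simp: m_def)
    then show ?thesis
      using red[of A C E]
      by (simp add: transformation_bracket_affine_field component h_aut_commutator affine_field_0 \<xi>
          left_invariant_metric_eq nb_simps)
  qed
  have "isometry (global_manifold (left_invariant_metric nb b)) (global_manifold (left_invariant_metric nb b)) \<phi>"
    if "\<phi> \<in> Iso_aut nb b" for \<phi>
    using that isometry_bch_mult by (auto simp: Iso_aut_def isometric_automorphisms_iff)
  moreover have "\<exists>\<phi>\<in>Iso_aut nb b. \<phi> x = y" for x y
  proof (rule bexI[OF _ group_Iso_aut(4)])
    \<comment> \<open>Translation by the product of \<open>y\<close> with the inverse of
      \<open>x\<close> carries \<open>x\<close> to \<open>y\<close>.\<close>
    show "bch_mult nb (bch_mult nb y (- x)) x = y" by (simp add: bch_mult_group[OF lie nil])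
  qed
  moreover have "vf_direct_sum ?L k m"
    unfolding vf_direct_sum_def using subL subk subm km sum by blast
  ultimately show ?thesis
    unfolding naturally_reductive_def Let_def k_def[symmetric]
    using pseudo_riemannian_left_invariant_metric group_Iso_aut(1-3) inv nr by blast
qed

end

section \<open>Gradients of flat coordinates\<close>

text \<open>A product rule that needs differentiability of \<open>L\<close> only on each fixed
  vector; in finite dimension the basis expansion makes this enough.\<close>

lemma has_derivative_linear_family:
  fixes L :: "'a::real_normed_vector \<Rightarrow> 'b::euclidean_space \<Rightarrow> 'c::real_normed_vector"
  assumes lin: "\<And>q. linear (L q)" and D: "\<And>u. ((\<lambda>q. L q u) has_derivative D u) (at p)"
    and w: "(w has_derivative w') (at p)"
  shows "((\<lambda>q. L q (w q)) has_derivative (\<lambda>h. D (w p) h + L p (w' h))) (at p)"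
proof -
  have rep: "L q u = (\<Sum>i\<in>Basis. (u \<bullet> i) *\<^sub>R L q i)" for q u
    by (subst (1) euclidean_representation[of u, symmetric]) (simp only: linear_sum[OF lin] linear_scale[OF lin])
  have "((\<lambda>q. L q u) has_derivative (\<lambda>h. \<Sum>i\<in>Basis. (u \<bullet> i) *\<^sub>R D i h)) (at p)" for u
    unfolding rep[of _ u] by (intro has_derivative_sum has_derivative_scaleR_right D)
  \<comment> \<open>Linearity of \<open>D u\<close> in \<open>u\<close> is not assumed; it follows
    from uniqueness of derivatives.\<close>
  then have Drep: "D u = (\<lambda>h. \<Sum>i\<in>Basis. (u \<bullet> i) *\<^sub>R D i h)" for u
    using D has_derivative_unique by blast
  have "((\<lambda>q. L q (w q)) has_derivative
      (\<lambda>h. \<Sum>i\<in>Basis. (w p \<bullet> i) *\<^sub>R D i h + (w' h \<bullet> i) *\<^sub>R L p i)) (at p)"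
    unfolding rep[of _ "w _"] by (intro has_derivative_sum has_derivative_scaleR has_derivative_inner_left w D)
  then show ?thesis
    by (simp add: sum.distrib Drep[of "w p"] rep[of p "w' _"])
qed

text \<open>The same basis expansion, now for a metric at a moving base point with two moving
  arguments.\<close>

lemma has_derivative_bilinear_family:
  fixes G :: "'b::euclidean_space \<Rightarrow> 'b \<Rightarrow> 'b \<Rightarrow> real"
  assumes S: "open S" "p \<in> S" "\<And>x. x \<in> S \<Longrightarrow> F x \<in> T" and T: "open T"
    and bil: "\<And>y. y \<in> T \<Longrightarrow> bilinear (G y)"
    and diff: "\<And>y u v. y \<in> T \<Longrightarrow> (\<lambda>y. G y u v) differentiable (at y)"
    and F: "(F has_derivative F') (at p)" and a: "(a has_derivative a') (at p)" and c: "(c has_derivative c') (at p)"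
  shows "((\<lambda>x. G (F x) (a x) (c x)) has_derivative
    (\<lambda>h. G (F p) (a' h) (c p) + G (F p) (a p) (c' h) + frechet_derivative (\<lambda>y. G y (a p) (c p)) (at (F p)) (F' h))) (at p)"
proof -
  have Fp: "F p \<in> T" using S by blast
  define dG where "dG i j = frechet_derivative (\<lambda>y. G y i j) (at (F p))" for i j
  have dG: "((\<lambda>y. G y i j) has_derivative dG i j) (at (F p))" for i j
    unfolding dG_def using diff[OF Fp] by (simp add: frechet_derivative_works)
  have rep: "G y u v = (\<Sum>i\<in>Basis. \<Sum>j\<in>Basis. (u \<bullet> i) * (v \<bullet> j) * G y i j)" if "y \<in> T" for y u v
  proof -
    have "G y u v = G y (\<Sum>i\<in>Basis. (u \<bullet> i) *\<^sub>R i) (\<Sum>j\<in>Basis. (v \<bullet> j) *\<^sub>R j)"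
      by (simp add: euclidean_representation)
    also have "\<dots> = (\<Sum>(i, j)\<in>Basis \<times> Basis. G y ((u \<bullet> i) *\<^sub>R i) ((v \<bullet> j) *\<^sub>R j))"
      by (rule bilinear_sum[OF bil[OF that]])
    finally show ?thesis
      by (simp add: sum.cartesian_product[symmetric] bilinear_lmul[OF bil[OF that]] bilinear_rmul[OF bil[OF that]] mult_ac)
  qed
  have Q: "frechet_derivative (\<lambda>y. G y u v) (at (F p)) = (\<lambda>z. \<Sum>i\<in>Basis. \<Sum>j\<in>Basis. (u \<bullet> i) * (v \<bullet> j) * dG i j z)" for u v
  proof (rule frechet_derivative_at[symmetric])
    have "((\<lambda>y. \<Sum>i\<in>Basis. \<Sum>j\<in>Basis. (u \<bullet> i) * (v \<bullet> j) * G y i j) has_derivative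
        (\<lambda>z. \<Sum>i\<in>Basis. \<Sum>j\<in>Basis. (u \<bullet> i) * (v \<bullet> j) * dG i j z)) (at (F p))"
      by (intro has_derivative_sum has_derivative_mult_right dG)
    then show "((\<lambda>y. G y u v) has_derivative (\<lambda>z. \<Sum>i\<in>Basis. \<Sum>j\<in>Basis. (u \<bullet> i) * (v \<bullet> j) * dG i j z)) (at (F p))"
      by (rule has_derivative_transform_within_open[OF _ T Fp]) (simp add: rep)
  qed
  have "((\<lambda>x. \<Sum>i\<in>Basis. \<Sum>j\<in>Basis. (a x \<bullet> i) * (c x \<bullet> j) * G (F x) i j) has_derivative
      (\<lambda>h. \<Sum>i\<in>Basis. \<Sum>j\<in>Basis. (a p \<bullet> i) * (c p \<bullet> j) * dG i j (F' h)
         + ((a p \<bullet> i) * (c' h \<bullet> j) + (a' h \<bullet> i) * (c p \<bullet> j)) * G (F p) i j)) (at p)"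
    by (intro has_derivative_sum has_derivative_mult has_derivative_inner_left a c has_derivative_compose[OF F dG])
  then have "((\<lambda>x. G (F x) (a x) (c x)) has_derivative
      (\<lambda>h. \<Sum>i\<in>Basis. \<Sum>j\<in>Basis. (a p \<bullet> i) * (c p \<bullet> j) * dG i j (F' h)
         + ((a p \<bullet> i) * (c' h \<bullet> j) + (a' h \<bullet> i) * (c p \<bullet> j)) * G (F p) i j)) (at p)"
    by (rule has_derivative_transform_within_open[OF _ S(1,2)]) (rule rep[OF S(3), symmetric])
  then show ?thesis
  proof (rule has_derivative_eq_rhs, intro ext)
    fix h
    show "(\<Sum>i\<in>Basis. \<Sum>j\<in>Basis. (a p \<bullet> i) * (c p \<bullet> j) * dG i j (F' h)
         + ((a p \<bullet> i) * (c' h \<bullet> j) + (a' h \<bullet> i) * (c p \<bullet> j)) * G (F p) i j)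
      = G (F p) (a' h) (c p) + G (F p) (a p) (c' h) + frechet_derivative (\<lambda>y. G y (a p) (c p)) (at (F p)) (F' h)"
      unfolding Q rep[OF Fp, of "a' h" "c p"] rep[OF Fp, of "a p" "c' h"]
      by (simp add: sum.distrib algebra_simps)
  qed
qed

text \<open>
  A constant direction \<open>\<omega>\<close> is Killing and dual to the closed form \<open>\<kappa>\<close>. Differentiating the isometry
  condition on the pairs \<open>(u, V)\<close>, \<open>(x, V)\<close>, \<open>(u, x)\<close> in the directions \<open>x\<close>, \<open>u\<close>, \<open>V\<close> and combining
  the results as in the Koszul formula expresses the Hessian of \<open>\<kappa> \<circ> F\<close> by first derivatives of the metric.
\<close>

lemma hessian_flat_coordinate:
  fixes F :: "'a::real_normed_vector \<Rightarrow> 'b::euclidean_space" and G :: "'b \<Rightarrow> 'b \<Rightarrow> 'b \<Rightarrow> real"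
  assumes S: "open S" "p \<in> S" "\<And>x. x \<in> S \<Longrightarrow> F x \<in> T" and T: "open T"
    and F': "\<And>x. x \<in> S \<Longrightarrow> (F has_derivative F' x) (at x)"
    and F'': "\<And>x u. x \<in> S \<Longrightarrow> ((\<lambda>x. F' x u) has_derivative F'' x u) (at x)"
    and cont: "\<And>u v. isCont (\<lambda>x. F'' x u v) p"
    and bil: "\<And>y. y \<in> T \<Longrightarrow> bilinear (G y)" and sym: "\<And>y u v. y \<in> T \<Longrightarrow> G y u v = G y v u"
    and diff: "\<And>y u v. y \<in> T \<Longrightarrow> (\<lambda>y. G y u v) differentiable (at y)"
    and iso: "\<And>x u v. x \<in> S \<Longrightarrow> G (F x) (F' x u) (F' x v) = g x u v"
    and \<kappa>: "\<And>y u. y \<in> T \<Longrightarrow> G y u \<omega> = \<kappa> u"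
    and inv: "\<And>y u v t. y \<in> T \<Longrightarrow> G (y + t *\<^sub>R \<omega>) u v = G y u v"
    and V: "F' p V = \<omega>"
    and dg: "\<And>u v. ((\<lambda>x. g x u v) has_derivative dg u v) (at p)"
  shows "2 * \<kappa> (F'' p u x) = dg u V x + dg x V u - dg u x V"
proof -
  have Fp: "F p \<in> T" using S by blast
  define Q where "Q z u v = frechet_derivative (\<lambda>y. G y u v) (at (F p)) z" for z u v
  have Q: "((\<lambda>y. G y u v) has_derivative (\<lambda>z. Q z u v)) (at (F p))" for u v
    unfolding Q_def using diff[OF Fp] by (simp add: frechet_derivative_works)
  have E: "G (F p) (F'' p u h) (F' p v) + G (F p) (F' p u) (F'' p v h) + Q (F' p h) (F' p u) (F' p v) = dg u v h" for u v h
  proof -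
    have "((\<lambda>x. G (F x) (F' x u) (F' x v)) has_derivative
      (\<lambda>h. G (F p) (F'' p u h) (F' p v) + G (F p) (F' p u) (F'' p v h) + Q (F' p h) (F' p u) (F' p v))) (at p)"
      unfolding Q_def
      by (rule has_derivative_bilinear_family[OF S T bil diff F'[OF S(2)] F''[OF S(2)] F''[OF S(2)]])
    then have "((\<lambda>x. g x u v) has_derivative
      (\<lambda>h. G (F p) (F'' p u h) (F' p v) + G (F p) (F' p u) (F'' p v h) + Q (F' p h) (F' p u) (F' p v))) (at p)"
      by (rule has_derivative_transform_within_open[OF _ S(1,2)]) (rule iso)
    from has_derivative_unique[OF this dg] show ?thesis by (rule fun_cong)
  qed
  \<comment> \<open>Pairing with \<omega> gives \<kappa>, which does not depend on the base
    point.\<close>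
  have Q1: "Q z u \<omega> = 0" for z u
  proof -
    have "((\<lambda>y. G y u \<omega>) has_derivative (\<lambda>z. 0)) (at (F p))"
      by (rule has_derivative_transform_within_open[OF has_derivative_const[of "\<kappa> u"] T Fp]) (simp add: \<kappa>)
    from has_derivative_unique[OF Q this] show ?thesis by (rule fun_cong)
  qed
  \<comment> \<open>The metric is invariant under translation along \<omega>; this is the Killing
    property.\<close>
  have Q2: "Q \<omega> u v = 0" for u v
  proof -
    have "((\<lambda>t. G (F p + t *\<^sub>R \<omega>) u v) has_derivative (\<lambda>t. Q (t *\<^sub>R \<omega>) u v)) (at 0)"
      by (rule has_derivative_compose[of "\<lambda>t. F p + t *\<^sub>R \<omega>"]) (auto intro!: derivative_eq_intros Q)
    moreover have "((\<lambda>t. G (F p + t *\<^sub>R \<omega>) u v) has_derivative (\<lambda>t. 0)) (at 0)"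
      by (simp add: inv[OF Fp])
    ultimately have "(\<lambda>t. Q (t *\<^sub>R \<omega>) u v) = (\<lambda>t. 0)" by (rule has_derivative_unique)
    from fun_cong[OF this, of 1] show ?thesis by simp
  qed
  have F''sym: "F'' p u v = F'' p v u" for u v
    by (rule second_derivative_symmetric[OF S(1,2), where f' = F' and fu = "\<lambda>x. F'' x u" and fv = "\<lambda>x. F'' x v"])
       (auto intro: F' F'' cont)
  show ?thesis
    using E[of u x V] E[of x u V] E[of u V x]
    by (simp add: V Q1 Q2 \<kappa>[OF Fp] F''sym[of V] F''sym[of x u] sym[OF Fp, of "F'' p u V"])
qed

text \<open>The vector \<open>V\<close> is the gradient of \<open>f \<circ> \<phi>\<close>. Its
  square \<open>\<kappa> \<omega>\<close> is the same at all points, and the last conclusion says in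
  coordinates that the covariant Hessian vanishes. The hypotheses on the target concern one chart,
  so they apply with or without a factor \<open>M'\<close>.\<close>

lemma gradient_flat_coordinate:
  fixes \<phi> :: "'a::euclidean_space \<Rightarrow> 'm::topological_space" and d :: "('m, 'b::euclidean_space) metric_chart"
  defines "T \<equiv> chart_map d ` chart_dom d"
  assumes iso: "isometry (global_manifold g) M \<phi>" and d: "d \<in> M" and p: "\<phi> p \<in> chart_dom d"
    and dom: "open (chart_dom d)" "inj_on (chart_map d) (chart_dom d)" "open T"
    and bil: "\<And>y. y \<in> T \<Longrightarrow> bilinear (chart_metric d y)"
    and sym: "\<And>y u v. y \<in> T \<Longrightarrow> chart_metric d y u v = chart_metric d y v u"
    and diff: "\<And>y u v. y \<in> T \<Longrightarrow> (\<lambda>y. chart_metric d y u v) differentiable (at y)"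
    and \<kappa>: "\<And>y u. y \<in> T \<Longrightarrow> chart_metric d y u \<omega> = \<kappa> u"
    and inv: "\<And>y u v t. y \<in> T \<Longrightarrow> chart_metric d (y + t *\<^sub>R \<omega>) u v = chart_metric d y u v"
    and f: "\<And>x. x \<in> chart_dom d \<Longrightarrow> f x = \<kappa> (chart_map d x)"
    and dg: "\<And>u v. ((\<lambda>x. g x u v) has_derivative dg u v) (at p)"
  obtains V where "((\<lambda>x. f (\<phi> x)) has_derivative (\<lambda>u. g p u V)) (at p)" "g p V V = \<kappa> \<omega>"
    "\<And>u. ((\<lambda>x. frechet_derivative (\<lambda>x. f (\<phi> x)) (at x) u) has_derivative
        (\<lambda>x. (dg u V x + dg x V u - dg u x V) / 2)) (at p)"
proof -
  let ?G = "chart_metric d"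
  define S where "S = \<phi> -` chart_dom d"
  define F where "F = chart_map d \<circ> \<phi>"
  define R where "R = inv \<phi> \<circ> inv_into (chart_dom d) (chart_map d)"
  have hom: "homeomorphism UNIV UNIV \<phi> (Hilbert_Choice.inv \<phi>)"
    and c1: "chart_isometric \<lparr>chart_dom = UNIV, chart_map = id, chart_metric = g\<rparr> d \<phi>"
    and c2: "chart_isometric d \<lparr>chart_dom = UNIV, chart_map = id, chart_metric = g\<rparr> (Hilbert_Choice.inv \<phi>)"
    using iso d by (auto simp: isometry_def global_manifold_def)
  have S: "open S" "p \<in> S" "\<And>x. x \<in> S \<Longrightarrow> F x \<in> T"
    using hom dom(1) p by (auto simp: S_def F_def T_def homeomorphism_def intro: open_vimage)
  have smooth: "smooth_on F S" and isoF: "\<And>x u v. x \<in> S \<Longrightarrow>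
      ?G (F x) (frechet_derivative F (at x) u) (frechet_derivative F (at x) v) = g x u v"
    using c1 by (auto simp: chart_isometric_def Let_def S_def F_def)
  have smoothR: "smooth_on R T"
    using c2 by (auto simp: chart_isometric_def Let_def R_def T_def)
  define F' where "F' x = frechet_derivative F (at x)" for x
  define F'' where "F'' x u = frechet_derivative (\<lambda>x. F' x u) (at x)" for x u
  have "Ck_on (Suc (Suc 0)) F S" using smooth by (simp add: smooth_on_def)
  then have F': "\<And>x. x \<in> S \<Longrightarrow> (F has_derivative F' x) (at x)"
    and F'': "\<And>x u. x \<in> S \<Longrightarrow> ((\<lambda>x. F' x u) has_derivative F'' x u) (at x)"
    and cont: "\<And>u v. continuous_on S (\<lambda>x. F'' x u v)"
    by (simp_all add: F'_def F''_def frechet_derivative_works)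
  have FR: "F (R y) = y" if "y \<in> T" for y
    using that hom by (simp add: F_def R_def T_def homeomorphism_def f_inv_into_f)
  have RF: "R (F p) = p"
    using p hom dom(2) by (simp add: F_def R_def homeomorphism_def)
  have Fp: "F p \<in> T" using S by blast
  have "Ck_on 1 R T" using smoothR by (simp add: smooth_on_def)
  then have "R differentiable (at (F p))" using Fp by simp
  then obtain R' where R': "(R has_derivative R') (at (F p))" by (auto simp: differentiable_def)
  \<comment> \<open>The preimage of \<omega> under the differential of \<open>F\<close>, which is
    onto because the local inverse \<open>R\<close> is differentiable.\<close>
  define V where "V = R' \<omega>"
  have V: "F' p V = \<omega>"
  proof -
    have "((\<lambda>y. F (R y)) has_derivative (\<lambda>z. F' p (R' z))) (at (F p))"
      by (rule has_derivative_compose[OF R']) (simp add: RF F' S(2))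
    moreover have "((\<lambda>y. F (R y)) has_derivative (\<lambda>z. z)) (at (F p))"
      by (rule has_derivative_transform_within_open[OF has_derivative_ident dom(3) Fp]) (simp add: FR)
    ultimately have "(\<lambda>z. F' p (R' z)) = (\<lambda>z. z)" by (rule has_derivative_unique)
    then show ?thesis unfolding V_def by metis
  qed
  have bl\<kappa>: "bounded_linear \<kappa>"
  proof -
    have "\<kappa> = (\<lambda>u. ?G (F p) u \<omega>)" using \<kappa>[OF Fp] by auto
    then show ?thesis using bil[OF Fp] by (simp add: bilinear_def linear_conv_bounded_linear)
  qed
  have f\<phi>: "((\<lambda>x. f (\<phi> x)) has_derivative (\<lambda>u. \<kappa> (F' x u))) (at x)" if "x \<in> S" for x
    by (rule has_derivative_transform_within_open[OF bounded_linear.has_derivative[OF bl\<kappa> F'[OF that]] S(1) that])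
       (simp add: f F_def S_def)
  have isoF': "?G (F x) (F' x u) (F' x v) = g x u v" if "x \<in> S" for x u v
    using isoF[OF that] by (simp add: F'_def)
  have gV: "g p u V = \<kappa> (F' p u)" for u
    using isoF'[OF S(2), of u V] by (simp add: V \<kappa>[OF Fp])
  have hess: "2 * \<kappa> (F'' p u x) = dg u V x + dg x V u - dg u x V" for u x
    by (rule hessian_flat_coordinate[OF S dom(3) F' F'' _ bil sym diff isoF' \<kappa> inv V dg])
       (use cont S in \<open>auto simp: continuous_on_eq_continuous_at\<close>)
  show thesis
  proof (rule that)
    show "((\<lambda>x. f (\<phi> x)) has_derivative (\<lambda>u. g p u V)) (at p)"
      using f\<phi>[OF S(2)] by (simp add: gV)
    show "g p V V = \<kappa> \<omega>" by (simp add: gV V)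
    fix u
    have "((\<lambda>x. \<kappa> (F' x u)) has_derivative (\<lambda>x. \<kappa> (F'' p u x))) (at p)"
      by (rule bounded_linear.has_derivative[OF bl\<kappa> F''[OF S(2)]])
    then have "((\<lambda>x. frechet_derivative (\<lambda>x. f (\<phi> x)) (at x) u) has_derivative (\<lambda>x. \<kappa> (F'' p u x))) (at p)"
      by (rule has_derivative_transform_within_open[OF _ S(1,2)])
         (simp add: frechet_derivative_at[OF f\<phi>, symmetric])
    moreover have "(\<lambda>x. \<kappa> (F'' p u x)) = (\<lambda>x. (dg u V x + dg x V u - dg u x V) / 2)"
      unfolding hess[symmetric] by simp
    ultimately show "((\<lambda>x. frechet_derivative (\<lambda>x. f (\<phi> x)) (at x) u) has_derivative
        (\<lambda>x. (dg u V x + dg x V u - dg u x V) / 2)) (at p)" by simp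
  qed
qed

text \<open>By polarization, as the form is not zero. The metric may be indefinite, so an arbitrary
  nonzero vector could be null.\<close>

lemma metric_form_nonnull_vector:
  fixes b :: "'a::euclidean_space \<Rightarrow> 'a \<Rightarrow> real"
  assumes "metric_form b"
  obtains w where "b w w \<noteq> 0"
proof -
  have bil: "bilinear b" and sym: "\<And>x y. b x y = b y x" and nd: "\<And>x. (\<forall>y. b x y = 0) \<Longrightarrow> x = 0"
    using assms by (auto simp: metric_form_def)
  obtain e :: 'a where "e \<in> Basis" using nonempty_Basis by blast
  then have "e \<noteq> 0" by (simp add: nonzero_Basis)
  then obtain y where y: "b e y \<noteq> 0" using nd by blast
  have "b (e + y) (e + y) = b e e + b y y + 2 * b e y"
    using sym[of y e] by (simp add: bilinear_ladd[OF bil] bilinear_radd[OF bil])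
  with y have "b (e + y) (e + y) \<noteq> 0 \<or> b e e \<noteq> 0 \<or> b y y \<noteq> 0" by auto
  with that show thesis by blast
qed

context two_step_metric_lie_algebra
begin

lemma left_invariant_metric_has_derivative:
  "((\<lambda>p. left_invariant_metric nb b p u v) has_derivative
     (\<lambda>h. - (b (nb h u) (v - (1/2) *\<^sub>R nb p v) + b (u - (1/2) *\<^sub>R nb p u) (nb h v)) / 2)) (at p)"
proof -
  have d: "((\<lambda>p. w - (1/2) *\<^sub>R nb p w) has_derivative (\<lambda>h. 0 - (1/2) *\<^sub>R nb h w)) (at p)" for w
    by (intro has_derivative_diff has_derivative_const has_derivative_scaleR_right
        bounded_linear_imp_has_derivative bounded_bilinear.bounded_linear_left[OF bounded_bilinear_nb])
  show ?thesis
    unfolding left_invariant_metric_eq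
    by (rule has_derivative_eq_rhs[OF bounded_bilinear.FDERIV[OF bounded_bilinear_b d d]])
       (auto simp: b_simps fun_eq_iff field_simps)
qed

text \<open>The Koszul formula makes \<open>nabla\<close> the Levi-Civita connection on
  left-invariant fields, and \<open>grad\<close> says that the Hessian of \<open>f\<close> vanishes:
  differentiating \<open>W f\<close> along \<open>X\<close> gives \<open>(nabla X W) f\<close>.
  Symmetry of the second derivatives of \<open>W f\<close> then yields the curvature
  identity.\<close>

lemma flat_gradient_curvature:
  fixes f :: "'a \<Rightarrow> real"
  defines "g \<equiv> left_invariant_metric nb b"
  assumes koszul: "\<And>X W v. b (nabla X W) v = (b (nb X W) v - b W (nb X v) - b X (nb W v)) / 2"
    and grad: "\<And>p dg. (\<And>u v. ((\<lambda>x. g x u v) has_derivative dg u v) (at p)) \<Longrightarrow>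
      \<exists>V. (f has_derivative (\<lambda>u. g p u V)) (at p) \<and> g p V V = c \<and>
        (\<forall>u. ((\<lambda>x. frechet_derivative f (at x) u) has_derivative (\<lambda>x. (dg u V x + dg x V u - dg u x V) / 2)) (at p))"
  obtains v where "b v v = c" "\<And>X Y W. b (nabla X (nabla Y W) - nabla Y (nabla X W) - nabla (nb X Y) W) v = 0"
proof -
  \<comment> \<open>The derivative of \<open>f\<close> along the left-invariant field with value
    \<open>W\<close> at \<open>0\<close>.\<close>
  define \<Lambda> where "\<Lambda> q W = frechet_derivative f (at q) (W + (1/2) *\<^sub>R nb q W)" for q W
  have eqI: "x = y" if "\<And>v. b x v = b y v" for x y
    using b_nondegenerate[of "x - y"] that by (simp add: b_simps)
  have bil: "bilinear nabla"
    unfolding bilinear_def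
    by (intro conjI allI linearI eqI) (simp_all add: koszul b_simps nb_simps algebra_simps add_divide_distrib diff_divide_distrib)
  then have bb: "bounded_bilinear nabla" by (simp add: bilinear_conv_bounded_bilinear)
  note grad' = grad[OF left_invariant_metric_has_derivative[folded g_def]]
  have lin: "linear (frechet_derivative f (at q))" for q
    using grad'[of q] has_derivative_linear by (metis frechet_derivative_at)
  have ex: "\<exists>v. b v v = c \<and> (\<forall>W. \<Lambda> q W = b W v) \<and>
    (\<forall>W. ((\<lambda>q. \<Lambda> q W) has_derivative (\<lambda>h. \<Lambda> q (nabla (h - (1/2) *\<^sub>R nb q h) W))) (at q))" for q
  proof -
    obtain V where V: "(f has_derivative (\<lambda>u. g q u V)) (at q)" "g q V V = c"
      and hess: "\<And>u. ((\<lambda>x. frechet_derivative f (at x) u) has_derivative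
        (\<lambda>x. (- (b (nb x u) (V - (1/2) *\<^sub>R nb q V) + b (u - (1/2) *\<^sub>R nb q u) (nb x V)) / 2
          + - (b (nb u x) (V - (1/2) *\<^sub>R nb q V) + b (x - (1/2) *\<^sub>R nb q x) (nb u V)) / 2
          - - (b (nb V u) (x - (1/2) *\<^sub>R nb q x) + b (u - (1/2) *\<^sub>R nb q u) (nb V x)) / 2) / 2)) (at q)"
      using grad'[of q] by blast
    define v where "v = V - (1/2) *\<^sub>R nb q V"
    have fd: "frechet_derivative f (at q) u = b (u - (1/2) *\<^sub>R nb q u) v" for u
      using frechet_derivative_at[OF V(1)] by (simp add: g_def left_invariant_metric_eq v_def fun_eq_iff)
    have \<Lambda>: "\<Lambda> q W = b W v" for W
      by (simp add: \<Lambda>_def fd nb_simps)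
    have "((\<lambda>q. \<Lambda> q W) has_derivative (\<lambda>h. \<Lambda> q (nabla (h - (1/2) *\<^sub>R nb q h) W))) (at q)" for W
    proof -
      have w: "((\<lambda>q. W + (1/2) *\<^sub>R nb q W) has_derivative (\<lambda>h. 0 + (1/2) *\<^sub>R nb h W)) (at q)"
        by (intro has_derivative_add has_derivative_const has_derivative_scaleR_right
            bounded_linear_imp_has_derivative bounded_bilinear.bounded_linear_left[OF bounded_bilinear_nb])
      show ?thesis
        unfolding \<Lambda>_def[abs_def]
      proof (rule has_derivative_eq_rhs[OF has_derivative_linear_family[OF lin hess w]], rule ext)
        fix h
        \<comment> \<open>The direction \<open>h\<close>, pulled back to the neutral
          element.\<close>
        define X where "X = h - (1/2) *\<^sub>R nb q h"
        have h: "h = X + (1/2) *\<^sub>R nb q X" and V': "V = v + (1/2) *\<^sub>R nb q v"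
          by (simp_all add: X_def v_def nb_simps)
        have "frechet_derivative f (at q) (nabla X W + (1/2) *\<^sub>R nb q (nabla X W))
          = (b (nb X W) v - b W (nb X v) - b X (nb W v)) / 2"
          using \<Lambda>[of "nabla X W"] by (simp add: \<Lambda>_def koszul)
        then show "(- (b (nb h (W + (1/2) *\<^sub>R nb q W)) (V - (1/2) *\<^sub>R nb q V)
              + b (W + (1/2) *\<^sub>R nb q W - (1/2) *\<^sub>R nb q (W + (1/2) *\<^sub>R nb q W)) (nb h V)) / 2
            + - (b (nb (W + (1/2) *\<^sub>R nb q W) h) (V - (1/2) *\<^sub>R nb q V)
              + b (h - (1/2) *\<^sub>R nb q h) (nb (W + (1/2) *\<^sub>R nb q W) V)) / 2
            - - (b (nb V (W + (1/2) *\<^sub>R nb q W)) (h - (1/2) *\<^sub>R nb q h)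
              + b (W + (1/2) *\<^sub>R nb q W - (1/2) *\<^sub>R nb q (W + (1/2) *\<^sub>R nb q W)) (nb V h)) / 2) / 2
            + frechet_derivative f (at q) (0 + (1/2) *\<^sub>R nb h W)
          = frechet_derivative f (at q) (nabla (h - (1/2) *\<^sub>R nb q h) W
            + (1/2) *\<^sub>R nb q (nabla (h - (1/2) *\<^sub>R nb q h) W))"
          unfolding X_def[symmetric] fd
          unfolding h V'
          using nb_skew[of W X] nb_skew[of v W] nb_skew[of v X] b_sym[of "nb W v" X]
          by (simp add: nb_simps b_simps koszul field_simps)
      qed
    qed
    moreover have "b v v = c" using V(2) by (simp add: g_def left_invariant_metric_eq v_def)
    ultimately show ?thesis using \<Lambda> by blast
  qed
  then have d\<Lambda>: "((\<lambda>q. \<Lambda> q W) has_derivative (\<lambda>h. \<Lambda> q (nabla (h - (1/2) *\<^sub>R nb q h) W))) (at q)" for q W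
    by blast
  obtain v where v: "b v v = c" "\<And>W. \<Lambda> 0 W = b W v" using ex[of 0] by blast
  have lin\<Lambda>: "linear (\<Lambda> q)" for q
    unfolding \<Lambda>_def using linear_compose[OF linear_translation lin] by (simp add: o_def)
  note d\<Lambda>' = has_derivative_linear_family[OF lin\<Lambda> d\<Lambda>]
  have aff: "((\<lambda>q. X - (1/2) *\<^sub>R nb q X) has_derivative (\<lambda>h. 0 - (1/2) *\<^sub>R nb h X)) (at q)" for q X
    by (intro has_derivative_diff has_derivative_const has_derivative_scaleR_right
        bounded_linear_imp_has_derivative bounded_bilinear.bounded_linear_left[OF bounded_bilinear_nb])
  note d1 = bounded_bilinear.FDERIV[OF bb aff has_derivative_const]
  note d2 = bounded_bilinear.FDERIV[OF bb aff d1]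
  show thesis
  proof (rule that[OF v(1)])
    fix X Y W
    \<comment> \<open>Second derivative of \<open>\<Lambda> _ W\<close>; the last term comes from
      the frame coefficient, which depends on \<open>q\<close>.\<close>
    define D where "D X q h = \<Lambda> q (nabla (h - (1/2) *\<^sub>R nb q h) (nabla (X - (1/2) *\<^sub>R nb q X) W))
        + \<Lambda> q (nabla (- (1/2) *\<^sub>R nb h X) W)" for X q h
    have D: "((\<lambda>q. \<Lambda> q (nabla (X - (1/2) *\<^sub>R nb q X) W)) has_derivative D X q) (at q)" for X q
      by (rule has_derivative_eq_rhs[OF d\<Lambda>'[OF d1]])
         (simp add: D_def fun_eq_iff bilinear_rzero[OF bil])
    have C: "isCont (\<lambda>q. D X q Y) 0" for X Y
      unfolding D_def
      by (intro isCont_add has_derivative_continuous[OF d\<Lambda>'[OF d2]] has_derivative_continuous[OF d\<Lambda>])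
    \<comment> \<open>The coefficient terms of the two sides, each half of a
      \<open>nabla (nb _ _) W\<close>, add up to the bracket term of the curvature.\<close>
    have "D X 0 Y = D Y 0 X"
      by (rule second_derivative_symmetric_real[OF open_UNIV UNIV_I d\<Lambda> D D C C])
    then show "b (nabla X (nabla Y W) - nabla Y (nabla X W) - nabla (nb X Y) W) v = 0"
      using nb_skew[of Y X]
      by (simp add: D_def v nb_simps bilinear_lmul[OF bil] bilinear_lneg[OF bil] b_simps field_simps)
  qed
qed

text \<open>The function is the inner product of the flat component with a non-null
  \<open>w\<close>, so its gradient has the constant square \<open>g0 w w\<close>.\<close>

theorem flat_factor_curvature:
  assumes koszul: "\<And>X W v. b (nabla X W) v = (b (nb X W) v - b W (nb X v) - b X (nb W v)) / 2"
    and split: "splits_off_flat_factor TYPE('k::euclidean_space) TYPE('m::{t2_space, second_countable_topology})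
        TYPE('e::euclidean_space) (global_manifold (left_invariant_metric nb b))"
  obtains v where "b v v \<noteq> 0" "\<And>X Y W. b (nabla X (nabla Y W) - nabla Y (nabla X W) - nabla (nb X Y) W) v = 0"
proof -
  let ?g = "left_invariant_metric nb b"
  obtain g0 :: "'k \<Rightarrow> 'k \<Rightarrow> real" where g0: "metric_form g0" and
    split': "(\<exists>(M' :: ('m, 'e) metric_chart set) \<phi>. pseudo_riemannian_manifold M' \<and>
            isometry (global_manifold ?g) (product_manifold (global_manifold (\<lambda>_. g0)) M') \<phi>) \<or>
         (\<exists>\<phi>. isometry (global_manifold ?g) (global_manifold (\<lambda>_. g0)) \<phi>)"
    using split unfolding splits_off_flat_factor_def by blast
  obtain w where w: "g0 w w \<noteq> 0" using metric_form_nonnull_vector[OF g0] .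
  have bil0: "bilinear g0" and sym0: "\<And>x y. g0 x y = g0 y x" using g0 by (auto simp: metric_form_def)
  from split' show thesis
  proof (elim disjE exE conjE)
    fix M' :: "('m, 'e) metric_chart set" and \<phi>
    assume M': "pseudo_riemannian_manifold M'"
      and iso: "isometry (global_manifold ?g) (product_manifold (global_manifold (\<lambda>_. g0)) M') \<phi>"
    show thesis
    proof (rule flat_gradient_curvature[OF koszul, of "\<lambda>x. g0 (fst (\<phi> x)) w" "g0 w w"])
      fix p dg assume dg: "\<And>u v. ((\<lambda>x. ?g x u v) has_derivative dg u v) (at p)"
      \<comment> \<open>Any chart of \<open>M'\<close> around the second component serves, since the
        product metric does not depend on the flat coordinate.\<close>
      obtain c where c: "c \<in> M'" "snd (\<phi> p) \<in> chart_dom c"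
        using M' unfolding pseudo_riemannian_manifold_def by blast
      define d where "d = product_chart \<lparr>chart_dom = UNIV, chart_map = id, chart_metric = (\<lambda>_. g0)\<rparr> c"
      have dM: "d \<in> product_manifold (global_manifold (\<lambda>_. g0)) M'"
        using c by (auto simp: d_def product_manifold_def global_manifold_def)
      have ok: "metric_chart_ok c" using M' c by (auto simp: pseudo_riemannian_manifold_def)
      have d: "chart_dom d = UNIV \<times> chart_dom c" "chart_map d = map_prod id (chart_map c)"
        "chart_metric d y u v = g0 (fst u) (fst v) + chart_metric c (snd y) (snd u) (snd v)" for y u v
        by (auto simp: d_def product_chart_def)
      have T: "chart_map d ` chart_dom d = UNIV \<times> chart_map c ` chart_dom c"
        unfolding d by (rule map_prod_surj_on) auto
      have inj: "inj_on (chart_map c) (chart_dom c)"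
        using ok by (auto simp: metric_chart_ok_def homeomorphism_def intro: inj_on_inverseI)
      have mf: "metric_form (chart_metric c y)" if "y \<in> chart_map c ` chart_dom c" for y
        using ok that unfolding metric_chart_ok_def by blast
      have bilc: "bilinear (chart_metric c y)" and symc: "chart_metric c y u v = chart_metric c y v u"
        if "y \<in> chart_map c ` chart_dom c" for y u v
        using mf[OF that] by (auto simp: metric_form_def)
      have diffc: "(\<lambda>y. chart_metric c y u v) differentiable (at y)" if "y \<in> chart_map c ` chart_dom c" for y u v
      proof -
        have "Ck_on 1 (\<lambda>y. chart_metric c y u v) (chart_map c ` chart_dom c)"
          using ok by (simp add: metric_chart_ok_def smooth_on_def)
        then show ?thesis using that by auto
      qed
      show "\<exists>V. ((\<lambda>x. g0 (fst (\<phi> x)) w) has_derivative (\<lambda>u. ?g p u V)) (at p) \<and> ?g p V V = g0 w w \<and>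
        (\<forall>u. ((\<lambda>x. frechet_derivative (\<lambda>x. g0 (fst (\<phi> x)) w) (at x) u) has_derivative
          (\<lambda>x. (dg u V x + dg x V u - dg u x V) / 2)) (at p))"
      proof (rule gradient_flat_coordinate[OF iso dM, where f = "\<lambda>z. g0 (fst z) w" and \<omega> = "(w, 0)"
            and \<kappa> = "\<lambda>u. g0 (fst u) w" and dg = dg and p = p])
        show "\<phi> p \<in> chart_dom d" using c(2) by (cases "\<phi> p") (auto simp: d)
        show "open (chart_dom d)" "open (chart_map d ` chart_dom d)"
          using ok unfolding T unfolding d(1) by (auto intro!: open_Times simp: metric_chart_ok_def)
        show "inj_on (chart_map d) (chart_dom d)" using inj by (auto simp: d inj_on_def)
        show "bilinear (chart_metric d y)" if "y \<in> chart_map d ` chart_dom d" for y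
        proof -
          have y: "snd y \<in> chart_map c ` chart_dom c" using that by (auto simp: T)
          show ?thesis
            unfolding bilinear_def d(3)
            by (intro conjI allI linearI)
               (simp_all add: bilinear_ladd[OF bil0] bilinear_radd[OF bil0] bilinear_lmul[OF bil0] bilinear_rmul[OF bil0]
                 bilinear_ladd[OF bilc[OF y]] bilinear_radd[OF bilc[OF y]] bilinear_lmul[OF bilc[OF y]] bilinear_rmul[OF bilc[OF y]]
                 algebra_simps)
        qed
        show "chart_metric d y u v = chart_metric d y v u" if "y \<in> chart_map d ` chart_dom d" for y u v
          using that symc sym0 by (auto simp: T d(3))
        show "(\<lambda>y. chart_metric d y u v) differentiable at y" if "y \<in> chart_map d ` chart_dom d" for y u v
        proof -
          have "((\<lambda>y. chart_metric c y (snd u) (snd v)) \<circ> snd) differentiable at y"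
            using that diffc[of "snd y"]
            by (intro differentiable_chain_at[OF bounded_linear_imp_differentiable[OF bounded_linear_snd]]) (auto simp: T)
          then show ?thesis unfolding d(3) by (intro differentiable_add) (auto simp: o_def)
        qed
        show "chart_metric d y u (w, 0) = g0 (fst u) w" if "y \<in> chart_map d ` chart_dom d" for y u
          using that bilinear_rzero[OF bilc] by (auto simp: T d(3))
        show "chart_metric d (y + t *\<^sub>R (w, 0)) u v = chart_metric d y u v" for y u v t
          by (simp add: d(3))
        show "g0 (fst x) w = g0 (fst (chart_map d x)) w" for x by (simp add: d(2))
        show "((\<lambda>x. ?g x u v) has_derivative dg u v) (at p)" for u v by (rule dg)
      qed (simp, blast)
    next
      fix v assume v: "b v v = g0 w w" "\<And>X Y W. b (nabla X (nabla Y W) - nabla Y (nabla X W) - nabla (nb X Y) W) v = 0"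
      show thesis by (rule that[of v]) (simp add: v(1) w, rule v(2))
    qed
  next
    fix \<phi> assume iso: "isometry (global_manifold ?g) (global_manifold (\<lambda>_. g0)) \<phi>"
    define d where "d = \<lparr>chart_dom = UNIV, chart_map = id, chart_metric = (\<lambda>_. g0)\<rparr>"
    have dM: "d \<in> global_manifold (\<lambda>_. g0)" by (simp add: d_def global_manifold_def)
    show thesis
    proof (rule flat_gradient_curvature[OF koszul, of "\<lambda>x. g0 (\<phi> x) w" "g0 w w"])
      fix p dg assume dg: "\<And>u v. ((\<lambda>x. ?g x u v) has_derivative dg u v) (at p)"
      show "\<exists>V. ((\<lambda>x. g0 (\<phi> x) w) has_derivative (\<lambda>u. ?g p u V)) (at p) \<and> ?g p V V = g0 w w \<and>
        (\<forall>u. ((\<lambda>x. frechet_derivative (\<lambda>x. g0 (\<phi> x) w) (at x) u) has_derivative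
          (\<lambda>x. (dg u V x + dg x V u - dg u x V) / 2)) (at p))"
        by (rule gradient_flat_coordinate[OF iso dM, where f = "\<lambda>z. g0 z w" and \<omega> = w
              and \<kappa> = "\<lambda>u. g0 u w" and dg = dg and p = p])
           (auto simp: d_def bil0 intro: sym0 dg)
    next
      fix v assume v: "b v v = g0 w w" "\<And>X Y W. b (nabla X (nabla Y W) - nabla Y (nabla X W) - nabla (nb X Y) W) v = 0"
      show thesis by (rule that[of v]) (simp add: v(1) w, rule v(2))
    qed
  qed
qed

end

section \<open>Lorentzian data sets\<close>

text \<open>The form is positive definite on the orthogonal complement of the negative basis vector
  \<open>e0\<close>, and some combination of \<open>u\<close> and \<open>z\<close> lies in that
  complement.\<close>

lemma lorentzian_form_orthogonal_positive:
  assumes "lorentzian_form b" and u: "b u u < 0" and uz: "b u z = 0" and z: "z \<noteq> 0"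
  shows "b z z > 0"
proof -
  obtain B where B: "finite B" "span B = UNIV" "\<forall>x\<in>B. \<forall>y\<in>B. x \<noteq> y \<longrightarrow> b x y = 0"
    "\<forall>x\<in>B. b x x = 1 \<or> b x x = - 1" and card: "card {x\<in>B. b x x = - 1} = 1"
    using assms(1) unfolding lorentzian_form_def by (elim conjE exE) (rule that)
  have bil: "bilinear b" and sym: "\<And>x y. b x y = b y x" and nd: "\<And>x. (\<forall>y. b x y = 0) \<Longrightarrow> x = 0"
    using assms(1) by (auto simp: lorentzian_form_def metric_form_def)
  have lin: "linear (b x)" for x using bil by (simp add: bilinear_def)
  note s = bilinear_ladd[OF bil] bilinear_radd[OF bil] bilinear_lmul[OF bil] bilinear_rmul[OF bil]
    bilinear_lsub[OF bil] bilinear_rsub[OF bil]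
  obtain e0 where e0: "{x\<in>B. b x x = - 1} = {e0}" using card card_1_singletonE by blast
  have zero: "x = 0" if "\<And>e. e \<in> B \<Longrightarrow> b x e = 0" for x
  proof -
    have "b x y = 0" for y
      using linear_eq_0_on_span[OF lin that, of B y] B(2) by auto
    then show ?thesis using nd by blast
  qed
  \<comment> \<open>The factor \<open>b e e\<close> is its own inverse, being 1 or -1.\<close>
  have rep: "x = (\<Sum>e\<in>B. (b e e * b x e) *\<^sub>R e)" for x
  proof -
    have "b (x - (\<Sum>e\<in>B. (b e e * b x e) *\<^sub>R e)) e' = 0" if e': "e' \<in> B" for e'
    proof -
      have "b (\<Sum>e\<in>B. (b e e * b x e) *\<^sub>R e) e' = (\<Sum>e\<in>B. b e e * b x e * b e' e)"
        unfolding sym[of _ e'] by (simp add: linear_sum[OF lin] linear_scale[OF lin] sym[of e'])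
      also have "\<dots> = (\<Sum>e\<in>B. if e = e' then b e e * b x e * b e' e else 0)"
        by (rule sum.cong) (use B(3) e' in auto)
      also have "\<dots> = b x e'" using B(1) B(4)[rule_format, OF e'] e' by (auto simp: sum.delta')
      finally show ?thesis by (simp add: s)
    qed
    from zero[OF this] show ?thesis by simp
  qed
  have sq: "b x x = (\<Sum>e\<in>B. b e e * (b x e)\<^sup>2)" for x
  proof -
    have "b x x = b x (\<Sum>e\<in>B. (b e e * b x e) *\<^sub>R e)" using rep[of x] by simp
    then show ?thesis by (simp add: linear_sum[OF lin] linear_scale[OF lin] power2_eq_square mult.assoc)
  qed
  have nonneg: "b e e * (b x e)\<^sup>2 \<ge> 0" if x0: "b x e0 = 0" and e: "e \<in> B" for x e
  proof (cases "e = e0")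
    case False
    then have "b e e \<noteq> - 1" using e0 e by blast
    then have "b e e = 1" using B(4)[rule_format, OF e] by blast
    then show ?thesis by simp
  qed (simp add: x0)
  have ge: "b x x \<ge> 0" if "b x e0 = 0" for x
    unfolding sq[of x] using nonneg[OF that] by (rule sum_nonneg)
  have gt: "b x x > 0" if x0: "b x e0 = 0" and "x \<noteq> 0" for x
  proof (rule ccontr)
    assume "\<not> b x x > 0"
    then have "(\<Sum>e\<in>B. b e e * (b x e)\<^sup>2) = 0" using ge[OF x0] sq[of x] by simp
    then have "\<forall>e\<in>B. b e e * (b x e)\<^sup>2 = 0"
      using sum_nonneg_eq_0_iff[OF B(1) nonneg[OF x0]] by simp
    then have eq: "b e e * (b x e)\<^sup>2 = 0" if "e \<in> B" for e using that by blast
    have "x = 0"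
    proof (rule zero)
      fix e assume e: "e \<in> B"
      have "b e e \<noteq> 0" using B(4)[rule_format, OF e] by auto
      with eq[OF e] show "b x e = 0" by simp
    qed
    with \<open>x \<noteq> 0\<close> show False by simp
  qed
  \<comment> \<open>The combination of \<open>u\<close> and \<open>z\<close> that is orthogonal to
    \<open>e0\<close>.\<close>
  define w where "w = b z e0 *\<^sub>R u - b u e0 *\<^sub>R z"
  have "b w e0 = 0" by (simp add: w_def s)
  then have "b w w \<ge> 0" by (rule ge)
  moreover have "b w w = (b z e0)\<^sup>2 * b u u + (b u e0)\<^sup>2 * b z z"
    using uz sym[of z u] by (simp add: w_def s power2_eq_square)
  ultimately have *: "(b u e0)\<^sup>2 * b z z \<ge> (b z e0)\<^sup>2 * (- b u u)" by simp
  have "b u e0 \<noteq> 0" using ge[of u] u by auto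
  show ?thesis
  proof (cases "b z e0 = 0")
    case False
    then have "(b z e0)\<^sup>2 * (- b u u) > 0" using u by (intro mult_pos_pos) auto
    with * have "(b u e0)\<^sup>2 * b z z > 0" by linarith
    then show ?thesis by (simp add: zero_less_mult_iff)
  qed (use gt z in auto)
qed

locale metric_data_set =
  fixes br :: "'g::euclidean_space \<Rightarrow> 'g \<Rightarrow> 'g" and bg :: "'g \<Rightarrow> 'g \<Rightarrow> real"
    and bv :: "'v::euclidean_space \<Rightarrow> 'v \<Rightarrow> real" and \<pi> :: "'g \<Rightarrow> 'v \<Rightarrow> 'v"
  assumes data: "data_set br bg bv \<pi>"
begin

abbreviation nb :: "'g \<times> 'v \<Rightarrow> 'g \<times> 'v \<Rightarrow> 'g \<times> 'v" where "nb \<equiv> n_bracket bg bv \<pi>"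
abbreviation b :: "'g \<times> 'v \<Rightarrow> 'g \<times> 'v \<Rightarrow> real" where "b \<equiv> n_metric bg bv"

lemma bil: "bilinear br" "bilinear bg" "bilinear bv" "bilinear \<pi>"
  and sym: "bg Z W = bg W Z" "bv X Y = bv Y X"
  and nondeg: "(\<And>W. bg Z W = 0) \<Longrightarrow> Z = 0" "(\<And>Y. bv X Y = 0) \<Longrightarrow> X = 0"
  and br_self: "br Z Z = 0"
  and br_skew: "bg (br Z W) W' = - bg W (br Z W')" and \<pi>_skew: "bv (\<pi> Z X) Y = - bv X (\<pi> Z Y)"
  and \<pi>_br: "\<pi> (br Z W) X = \<pi> Z (\<pi> W X) - \<pi> W (\<pi> Z X)" and \<pi>_inj: "inj \<pi>"
  using data unfolding data_set_def lie_bracket_def metric_form_def faithful_so_representation_def so_form_def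
    commutator_def eq_neg_iff_add_eq_0
  by (blast | simp)+

lemmas [simp] = bil[THEN bilinear_ladd] bil[THEN bilinear_radd] bil[THEN bilinear_lmul] bil[THEN bilinear_rmul]
  bil[THEN bilinear_lneg] bil[THEN bilinear_rneg] bil[THEN bilinear_lsub] bil[THEN bilinear_rsub]
  bil[THEN bilinear_lzero] bil[THEN bilinear_rzero] br_self

lemma eqI_g: "(\<And>W. bg Z W = bg Z' W) \<Longrightarrow> Z = Z'"
  using nondeg(1)[of "Z - Z'"] by simp

lemma eqI_v: "(\<And>Y. bv X Y = bv X' Y) \<Longrightarrow> X = X'"
  using nondeg(2)[of "X - X'"] by simp

lemma \<pi>_eqI: "(\<And>X. \<pi> Z X = \<pi> W X) \<Longrightarrow> Z = W"
  using \<pi>_inj by (meson ext injD)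

lemma br_anti: "br Z W = - br W Z"
  using br_self[of "Z + W"] br_self[of Z] br_self[of W]
  by (simp add: eq_neg_iff_add_eq_0 add.commute del: br_self)

lemma nb_fst: "bg (fst (nb p q)) Z = bv (\<pi> Z (snd p)) (snd q)"
  and nb_snd [simp]: "snd (nb p q) = 0"
  by (rule n_bracket_characterization[OF data])+

lemma nb_fst': "bg Z (fst (nb p q)) = bv (\<pi> Z (snd p)) (snd q)"
  using nb_fst sym by metis

lemma metric_form_b: "metric_form b"
  unfolding metric_form_def
proof (intro conjI allI impI)
  show "bilinear b"
    unfolding bilinear_def n_metric_def by (intro conjI allI linearI) (simp_all add: algebra_simps)
  show "b x y = b y x" for x y by (simp add: n_metric_def sym)
  fix x assume x: "\<forall>y. b x y = 0"
  have "fst x = 0" by (rule nondeg) (use x[rule_format, of "(_, 0)"] in \<open>simp add: n_metric_def\<close>)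
  moreover have "snd x = 0" by (rule nondeg) (use x[rule_format, of "(0, _)"] in \<open>simp add: n_metric_def\<close>)
  ultimately show "x = 0" by (simp add: prod_eq_iff)
qed

sublocale two_step_metric_lie_algebra nb b
  using n_bracket_two_step_nilpotent[OF data] metric_form_b by unfold_locales

lemma nb_eqI: "x = y" if "snd x = snd y" "\<And>Z. bg (fst x) Z = bg (fst y) Z"
  using that eqI_g by (auto simp: prod_eq_iff)

lemma xi_map_eq: "xi_map br \<pi> A x = (br (fst A) (fst x), \<pi> (fst A) (snd x))"
  by (cases A; cases x) (simp add: xi_map_def)

text \<open>Paired with \<open>Z\<close>, the derivation rule becomes the homomorphism property of
  \<pi>. Skewness is ad-invariance of \<open>bg\<close> together with skewness of \<pi>.\<close>

lemma xi_map_in_h_aut: "linear_into_h_aut nb b (xi_map br \<pi>)"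
  unfolding linear_into_h_aut_def h_aut_iff
proof (intro conjI allI)
  fix A x y :: "'g \<times> 'v"
  show "linear (xi_map br \<pi> A)" "linear (\<lambda>A. xi_map br \<pi> A x)"
    by (auto intro!: linearI simp: xi_map_eq)
  show "xi_map br \<pi> A (nb x y) = nb (xi_map br \<pi> A x) y + nb x (xi_map br \<pi> A y)"
  proof (rule nb_eqI)
    show "bg (fst (xi_map br \<pi> A (nb x y))) Z = bg (fst (nb (xi_map br \<pi> A x) y + nb x (xi_map br \<pi> A y))) Z" for Z
      using \<pi>_skew[of "fst A" "\<pi> Z (snd x)" "snd y"] by (simp add: xi_map_eq nb_fst br_skew \<pi>_br)
  qed (simp add: xi_map_eq)
  show "b (xi_map br \<pi> A x) y + b x (xi_map br \<pi> A y) = 0"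
    by (simp add: xi_map_eq n_metric_def br_skew \<pi>_skew)
qed

text \<open>Faithfulness says that only 0 in \<open>'g\<close> is orthogonal to all brackets. Moving
  \<open>L\<close> across the metric turns a bracket into a sum of brackets, which is orthogonal to
  \<open>(0, Y)\<close>.\<close>

lemma h_aut_fst:
  assumes L: "L \<in> h_aut nb b"
  shows "fst (L (0, Y)) = 0"
proof -
  have der: "L (nb p q) = nb (L p) q + nb p (L q)" and so: "b (L p) q = - b p (L q)" for p q
    using L unfolding h_aut_iff eq_neg_iff_add_eq_0 by blast+
  have "\<pi> (fst (L (0, Y))) X = \<pi> 0 X" for X
  proof (rule eqI_v)
    fix X'
    have "bv (\<pi> (fst (L (0, Y))) X) X' = b (nb (0, X) (0, X')) (L (0, Y))"
      by (simp add: n_metric_def nb_fst)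
    also have "\<dots> = - b (L (nb (0, X) (0, X'))) (0, Y)" by (simp add: so)
    also have "\<dots> = 0" by (simp add: der n_metric_def)
    finally show "bv (\<pi> (fst (L (0, Y))) X) X' = bv (\<pi> 0 X) X'" by simp
  qed
  then show ?thesis by (rule \<pi>_eqI)
qed

text \<open>With \<open>L\<close> split as \<open>L1\<close> and \<open>L2\<close>, the derivation
  rule says that \<open>\<pi> (L1 Z)\<close> is the commutator of \<open>L2\<close> and
  \<open>\<pi> Z\<close>. Faithfulness then makes \<open>L1\<close> a derivation of
  \<open>br\<close>.\<close>

lemma xi_map_equivariant: "h_aut_equivariant nb b (xi_map br \<pi>)"
  unfolding h_aut_equivariant_def
proof (intro ballI allI)
  fix L A assume L: "L \<in> h_aut nb b"
  have lin: "linear L" and der: "L (nb p q) = nb (L p) q + nb p (L q)" and so: "b (L p) q = - b p (L q)" for p q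
    using L unfolding h_aut_iff eq_neg_iff_add_eq_0 by blast+
  define L1 where "L1 Z = fst (L (Z, 0))" for Z
  define L2 where "L2 Y = snd (L (0, Y))" for Y
  have L0: "L (0, Y) = (0, L2 Y)" for Y by (simp add: L2_def h_aut_fst[OF L] prod_eq_iff)
  have L0': "L (Z, 0) = (L1 Z, 0)" for Z
  proof -
    have "snd (L (Z, 0)) = 0"
    proof (rule nondeg)
      show "bv (snd (L (Z, 0))) Y = 0" for Y
        using so[of "(Z, 0)" "(0, Y)"] by (simp add: n_metric_def L0)
    qed
    then show ?thesis by (simp add: L1_def prod_eq_iff)
  qed
  have L12: "L (Z, Y) = (L1 Z, L2 Y)" for Z Y
    using linear_add[OF lin, of "(Z, 0)" "(0, Y)"] by (simp add: L0 L0')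
  have lin2: "L2 (X + Y) = L2 X + L2 Y" "L2 (X - Y) = L2 X - L2 Y" for X Y
    using linear_add[OF lin, of "(0, X)" "(0, Y)"] linear_diff[OF lin, of "(0, X)" "(0, Y)"] by (simp_all add: L12)
  have so2: "bv (L2 X) Y = - bv X (L2 Y)" for X Y
    using so[of "(0, X)" "(0, Y)"] by (simp add: n_metric_def L0)
  have pi: "\<pi> (L1 Z) X = L2 (\<pi> Z X) - \<pi> Z (L2 X)" for Z X
  proof (rule eqI_v)
    fix Y
    have "bv (\<pi> (L1 Z) X) Y = b (nb (0, X) (0, Y)) (L (Z, 0))"
      by (simp add: n_metric_def nb_fst L1_def)
    also have "\<dots> = - b (L (nb (0, X) (0, Y))) (Z, 0)" by (simp add: so)
    also have "\<dots> = - bv (\<pi> Z (L2 X)) Y - bv (\<pi> Z X) (L2 Y)"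
      by (simp add: der n_metric_def nb_fst L0)
    also have "\<dots> = bv (L2 (\<pi> Z X) - \<pi> Z (L2 X)) Y" by (simp add: so2)
    finally show "bv (\<pi> (L1 Z) X) Y = bv (L2 (\<pi> Z X) - \<pi> Z (L2 X)) Y" .
  qed
  have ad: "br (L1 Z) W = L1 (br Z W) - br Z (L1 W)" for Z W
    by (rule \<pi>_eqI) (simp add: pi \<pi>_br lin2)
  show "xi_map br \<pi> (L A) = commutator L (xi_map br \<pi> A)"
    by (cases A) (auto simp: xi_map_eq commutator_def L12 pi ad fun_eq_iff)
qed

text \<open>The bracket and \<xi> contribute opposite terms by skewness of \<pi>; the contribution
  of \<open>br\<close> contains \<open>br Z Z\<close>.\<close>

lemma xi_map_geodesic_graph: "geodesic_graph nb b (xi_map br \<pi>)"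
  unfolding geodesic_graph_def
proof (intro allI)
  fix A B :: "'g \<times> 'v"
  show "b (fst (semidirect_bracket nb (A, xi_map br \<pi> A) (B, \<lambda>x. 0))) A = 0"
    using sym(2)[of "snd A" "\<pi> (fst A) (snd B)"]
    by (simp add: semidirect_bracket_def n_metric_def xi_map_eq nb_fst br_skew \<pi>_skew)
qed

text \<open>The \<open>nb\<close> term of each summand cancels against the \<open>xi_map\<close>
  term with the roles of \<open>A\<close> and its partner exchanged in the other; the
  \<open>br\<close> terms cancel by ad-invariance.\<close>

lemma xi_map_reductive:
  "b (nb A C + xi_map br \<pi> A C - xi_map br \<pi> C A) W + b C (nb A W + xi_map br \<pi> A W - xi_map br \<pi> W A) = 0"
  using br_anti[of "fst C" "fst A"] br_anti[of "fst W" "fst A"] sym(2)[of "snd C"]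
  by (simp add: n_metric_def xi_map_eq nb_fst nb_fst' br_skew \<pi>_skew)

section \<open>Levi-Civita connection on left-invariant fields and its curvature\<close>

definition nabla :: "'g \<times> 'v \<Rightarrow> 'g \<times> 'v \<Rightarrow> 'g \<times> 'v" where
  "nabla X W = ((1/2) *\<^sub>R fst (nb X W), - (1/2) *\<^sub>R (\<pi> (fst W) (snd X) + \<pi> (fst X) (snd W)))"

lemma nabla_koszul: "b (nabla X W) v = (b (nb X W) v - b W (nb X v) - b X (nb W v)) / 2"
  by (simp add: nabla_def n_metric_def nb_fst nb_fst' field_simps)

text \<open>
  The three conditions come from the curvature components \<open>R(X, Z) Z'\<close>, \<open>R(X, Z) Y\<close> and
  \<open>R(X\<^sub>0, Y) Y\<close> with \<open>Z, Z'\<close> in \<open>\<gg>\<close> and \<open>X, Y\<close> in \<open>\<vv>\<close>.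
\<close>

lemma curvature_nullity:
  assumes R: "\<And>X Y W. b (nabla X (nabla Y W) - nabla Y (nabla X W) - nabla (nb X Y) W) (Z0, X0) = 0"
  shows "\<pi> Z' (\<pi> Z X0) = 0" and "\<pi> Z (\<pi> Z0 X) = 0"
    and "Z0 = 0 \<Longrightarrow> bg (fst (nb (0, X0) (0, Y))) (fst (nb (0, X0) (0, Y))) = 0"
proof -
  have nb0: "nb (Z, 0) q = 0" "nb q (Z, 0) = 0" for Z q
    by (rule nb_eqI; simp add: nb_fst)+
  show "\<pi> Z' (\<pi> Z X0) = 0"
  proof (rule nondeg)
    fix Y
    \<comment> \<open>Here the curvature is \<open>- \<pi> Z (\<pi> Z' Y) / 4\<close>.\<close>
    have "bv (\<pi> Z (\<pi> Z' Y)) X0 = 0"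
      using R[of "(0, Y)" "(Z, 0)" "(Z', 0)"] by (simp add: nabla_def nb0 n_metric_def)
    then show "bv (\<pi> Z' (\<pi> Z X0)) Y = 0"
      using sym(2)[of X0 "\<pi> Z (\<pi> Z' Y)"] by (simp add: \<pi>_skew)
  qed
  show "\<pi> Z (\<pi> Z0 X) = 0"
  proof (rule nondeg)
    fix Y
    have "bv (\<pi> Z0 X) (\<pi> Z Y) = 0"
      using R[of "(0, X)" "(Z, 0)" "(0, Y)"] by (simp add: nabla_def nb0 n_metric_def nb_fst)
    then show "bv (\<pi> Z (\<pi> Z0 X)) Y = 0" by (simp add: \<pi>_skew)
  qed
  assume Z0: "Z0 = 0"
  define n where "n = fst (nb (0, X0) (0, Y))"
  have n: "nb (0, X0) (0, Y) = (n, 0)" by (simp add: n_def prod_eq_iff)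
  have "nb (0, Y) (0, Y) = 0" by simp
  \<comment> \<open>Here the curvature is \<open>3/4\<close> of \<open>\<pi> n Y\<close>; the next
    steps use that \<open>bv (\<pi> n X0) Y\<close> is the square of \<open>n\<close>.\<close>
  then have "bv (\<pi> n Y) X0 = 0"
    using R[of "(0, X0)" "(0, Y)" "(0, Y)"]
    by (simp add: nabla_def nb0 n_metric_def n Z0 field_simps)
  then have "bv (\<pi> n X0) Y = 0" using sym(2)[of X0 "\<pi> n Y"] by (simp add: \<pi>_skew)
  then show "bg (fst (nb (0, X0) (0, Y))) (fst (nb (0, X0) (0, Y))) = 0"
    unfolding nb_fst[of "(0, X0)"] by (simp add: n_def)
qed

text \<open>A vanishing product \<open>\<pi> Z' (\<pi> Z X0)\<close> puts \<open>\<pi> Z X0\<close>,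
  and then \<open>X0\<close>, into the trivial common kernel.\<close>

lemma lorentzian_curvature_nullity:
  assumes ker: "common_kernel \<pi> = {0}"
    and R: "\<And>X Y W. b (nabla X (nabla Y W) - nabla Y (nabla X W) - nabla (nb X Y) W) v = 0"
  shows "v = 0"
proof -
  obtain Z0 X0 where v: "v = (Z0, X0)" by fastforce
  have ker0: "X = 0" if "\<And>Z. \<pi> Z X = 0" for X using ker that by (auto simp: common_kernel_def)
  note c = curvature_nullity[OF R[unfolded v]]
  have "X0 = 0" by (rule ker0, rule ker0, rule c(1))
  moreover have "\<pi> Z0 X = 0" for X by (rule ker0, rule c(2))
  then have "Z0 = 0" by (rule \<pi>_eqI[of _ 0, simplified])
  ultimately show ?thesis by (simp add: v zero_prod_def)
qed

lemma degenerate_curvature_nullity: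
  assumes lor: "lorentzian_form b" and E: "E \<noteq> 0" "bv E E = 0"
    and ker: "common_kernel \<pi> = range (\<lambda>t. t *\<^sub>R E)"
    and R: "\<And>X Y W. b (nabla X (nabla Y W) - nabla Y (nabla X W) - nabla (nb X Y) W) v = 0"
  shows "b v v = 0"
proof -
  obtain Z0 X0 where v: "v = (Z0, X0)" by fastforce
  have ker': "\<exists>t. X = t *\<^sub>R E" if "\<And>Z. \<pi> Z X = 0" for X using ker that by (auto simp: common_kernel_def)
  note c = curvature_nullity[OF R[unfolded v]]
  \<comment> \<open>As \<open>E\<close> is null, a vector outside its orthogonal complement is
    needed to detect multiples of \<open>E\<close>.\<close>
  obtain F where F: "bv E F \<noteq> 0" using nondeg(2) E(1) by blast
  have null: "bv X (\<pi> Z X) = 0" for X Z using \<pi>_skew[of Z X X] sym(2)[of X "\<pi> Z X"] by simp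
  have "\<pi> Z0 X = 0" for X
  proof -
    obtain t where t: "\<pi> Z0 X = t *\<^sub>R E" using ker'[OF c(2)] by blast
    obtain s where s: "\<pi> Z0 F = s *\<^sub>R E" using ker'[OF c(2)] by blast
    have "s = 0" using null[of F Z0] F sym(2)[of F E] by (simp add: s)
    moreover have "t * bv X E = 0" using null[of X Z0] by (simp add: t)
    \<comment> \<open>Testing on \<open>X + F\<close> leaves \<open>t * bv F E = 0\<close>.\<close>
    ultimately have "t = 0" using null[of "X + F" Z0] F sym(2)[of F E] by (auto simp: s t)
    then show ?thesis by (simp add: t)
  qed
  then have Z0: "Z0 = 0" by (rule \<pi>_eqI[of _ 0, simplified])
  have pos: "bg Z Z > 0" if "Z \<noteq> 0" for Z
  proof -
    \<comment> \<open>The coefficient of \<open>E\<close> is chosen to make the square -1. This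
      timelike vector in \<open>'v\<close> uses up the only negative direction, so \<open>bg\<close>
      is positive definite.\<close>
    define u where "u = (- (bv F F + 1) / (2 * bv E F)) *\<^sub>R E + F"
    have "bv u u = -1" using F E sym(2)[of F E] by (simp add: u_def field_simps)
    then have "b (Z, 0) (Z, 0) > 0"
      using that by (intro lorentzian_form_orthogonal_positive[OF lor, of "(0, u)"]) (auto simp: n_metric_def zero_prod_def)
    then show ?thesis by (simp add: n_metric_def)
  qed
  have "\<pi> Z X0 = 0" for Z
  proof (rule nondeg)
    fix Y
    \<comment> \<open>Definiteness turns the null bracket into a zero bracket.\<close>
    have "fst (nb (0, X0) (0, Y)) = 0" using c(3)[OF Z0, of Y] pos by force
    then show "bv (\<pi> Z X0) Y = 0" using nb_fst[of "(0, X0)" "(0, Y)" Z] by simp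
  qed
  then obtain t where "X0 = t *\<^sub>R E" using ker' by blast
  then show ?thesis by (simp add: v Z0 n_metric_def E)
qed

end

theorem proposition4p6:
  fixes br :: "'g::euclidean_space \<Rightarrow> 'g \<Rightarrow> 'g"
    and bg :: "'g \<Rightarrow> 'g \<Rightarrow> real"
    and bv :: "'v::euclidean_space \<Rightarrow> 'v \<Rightarrow> real"
    and \<pi> :: "'g \<Rightarrow> 'v \<Rightarrow> 'v"
  assumes "lorentzian_data_set br bg bv \<pi> \<or> degenerate_lorentzian_data_set br bg bv \<pi>"
  shows "let nb = n_bracket bg bv \<pi>; b = n_metric bg bv; g = left_invariant_metric nb b; \<xi> = xi_map br \<pi>
    in naturally_reductive g (Iso_aut nb b) 0 \<and>
       \<not> splits_off_flat_factor TYPE('k::euclidean_space) TYPE('m::{t2_space, second_countable_topology})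
           TYPE('e::euclidean_space) (global_manifold g) \<and>
       linear_into_h_aut nb b \<xi> \<and> h_aut_equivariant nb b \<xi> \<and> geodesic_graph nb b \<xi>"
proof -
  interpret metric_data_set br bg bv \<pi>
    using assms by unfold_locales (auto simp: lorentzian_data_set_def degenerate_lorentzian_data_set_def)
  \<comment> \<open>Nullity, not vanishing, is what both kinds of data sets have in common.\<close>
  have null: "b v v = 0"
    if "\<And>X Y W. b (nabla X (nabla Y W) - nabla Y (nabla X W) - nabla (nb X Y) W) v = 0" for v
    using assms
  proof
    assume "lorentzian_data_set br bg bv \<pi>"
    then have "v = 0" by (intro lorentzian_curvature_nullity that) (auto simp: lorentzian_data_set_def)
    then show ?thesis by (simp add: n_metric_def)
  next
    assume "degenerate_lorentzian_data_set br bg bv \<pi>"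
    then show ?thesis
      unfolding degenerate_lorentzian_data_set_def using degenerate_curvature_nullity that by blast
  qed
  have "\<not> splits_off_flat_factor TYPE('k) TYPE('m) TYPE('e) (global_manifold (left_invariant_metric nb b))"
    using flat_factor_curvature[OF nabla_koszul] null by metis
  then show ?thesis
    unfolding Let_def
    using naturally_reductive_Iso_aut[OF xi_map_in_h_aut xi_map_equivariant xi_map_reductive]
      xi_map_in_h_aut xi_map_equivariant xi_map_geodesic_graph
    by blast
qed

end
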